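(* Let $m\ge 1$ be an integer and let $C$ be a simple closed $C^{m}$ curve in $\mathbb C$ with length $L$ and a unit speed counter-clockwise parametrization $z(s)$, $s\in[0,L]$. Assume that $C=\partial\Omega$ is the boundary curve of a domain $\Omega\subset\mathbb C$ with area $F$. Let $\boldsymbol n$ denote the outward-pointing unit normal on $C$ and $\boldsymbol\kappa$ the curvature vector of $C$. Assume $C$ has centroid $0$. Then $$ \begin{aligned} 0\le{}& \sum_{l=1}^{m-1} s_{m,l}\left(\frac{L}{2\pi}\right)^{2l-3}\int_{C}\left|\left(\frac{d}{ds}\right)^{l-1}\left(z+\left(\frac{L}{2\pi}\right)^{2}\boldsymbol\kappa\right)\right|^{2}ds\\ &-\frac{(-1)^m}{2}(m-1)!\,(m+1)!\left(\frac1\pi\left(L^2-4\pi F\right)-\frac{2\pi}{L}\int_C\left|z-\left(\frac{L}{2\pi}\right)\boldsymbol n\right|^2ds\right). \end{aligned} $$ Equality holds if and only if, in terms of the parameter $t=\frac{2\pi}{L}s$, $z(t)=be^{it}$ for some $0\neq b\in\mathbb C$.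
   Context: The plane is identified with $\mathbb C$, and $z$ is the position vector. The unit speed parametrization $z$ is regarded as an $L$-periodic function of class $C^m$ on $\mathbb R$. The curvature vector is $\boldsymbol\kappa=\frac{d^2z}{ds^2}$ (it appears only when $m\ge2$; for $m=1$ the sum over $l$ is empty). "Centroid $0$" means $\int_C z\,ds=0$. Constants $s_{m,l}$: let $\mathrm P_1(t)=1$ and $\mathrm P_m(t)=\prod_{j=2}^m(t-j^2)$ for $m\ge2$. For $m\geq 2$ the numbers $s_{m,1},\dots,s_{m,m-1}$ are the coefficients of the polynomial $$\mathrm S_m(t)=\frac{\mathrm P_m(t)-\mathrm P_m(1)}{t-1}=\sum_{l=1}^{m-1}s_{m,l}\,t^{l-1}.$$ *)

theory Defs
  imports
    "HOL-Complex_Analysis.Complex_Analysis"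
    "HOL-Computational_Algebra.Computational_Algebra"
begin

definition iterated_derivative :: "nat \<Rightarrow> (real \<Rightarrow> 'a::real_normed_vector) \<Rightarrow> real \<Rightarrow> 'a"
  where "iterated_derivative k f = ((\<lambda>g s. vector_derivative g (at s)) ^^ k) f"

text \<open>The differentiability clause is needed because \<^const>\<open>vector_derivative\<close> is total.\<close>

definition Ck :: "nat \<Rightarrow> (real \<Rightarrow> 'a::real_normed_vector) \<Rightarrow> bool"
  where "Ck m f \<longleftrightarrow>
    (\<forall>k<m. \<forall>s. iterated_derivative k f differentiable (at s)) \<and>
    continuous_on UNIV (iterated_derivative m f)"

definition curvature_vector :: "(real \<Rightarrow> complex) \<Rightarrow> real \<Rightarrow> complex"
  where "curvature_vector z = iterated_derivative 2 z"

text \<open>One period of an \<open>L\<close>-periodic function, as a path on \<open>[0,1]\<close>.\<close>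

definition loop_of :: "real \<Rightarrow> (real \<Rightarrow> complex) \<Rightarrow> real \<Rightarrow> complex"
  where "loop_of L z = (\<lambda>t. z (L * t))"

definition counterclockwise :: "complex set \<Rightarrow> (real \<Rightarrow> complex) \<Rightarrow> bool"
  where "counterclockwise \<Omega> \<gamma> \<longleftrightarrow> (\<forall>w\<in>\<Omega>. winding_number \<gamma> w = 1)"

text \<open>\<open>\<nu>\<close> is the unit normal at \<open>z s\<close>, on the boundary of \<open>\<Omega>\<close>, that points out of \<open>\<Omega>\<close>.\<close>

definition outward_unit_normal ::
    "complex set \<Rightarrow> (real \<Rightarrow> complex) \<Rightarrow> real \<Rightarrow> complex \<Rightarrow> bool"
  where "outward_unit_normal \<Omega> z s \<nu> \<longleftrightarrow>
    norm \<nu> = 1 \<and>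
    \<nu> \<bullet> vector_derivative z (at s) = 0 \<and>
    (\<forall>\<^sub>F \<epsilon> in at_right 0. z s + \<epsilon> *\<^sub>R \<nu> \<notin> closure \<Omega>)"

definition P_poly :: "nat \<Rightarrow> real poly"
  where "P_poly m = (\<Prod>j=2..m. [:- ((real j)\<^sup>2), 1:])"

definition S_poly :: "nat \<Rightarrow> real poly"
  where "S_poly m = (P_poly m - [:poly (P_poly m) 1:]) div [:- 1, 1:]"

lemma S_poly_exact: "[:- 1, 1:] * S_poly m = P_poly m - [:poly (P_poly m) 1:]"
proof -
  have "[:- 1, 1:] dvd P_poly m - [:poly (P_poly m) 1:]"
    using poly_eq_0_iff_dvd[of "P_poly m - [:poly (P_poly m) 1:]" 1] by simp
  then show ?thesis
    unfolding S_poly_def by (rule dvd_mult_div_cancel)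
qed

definition s_coeff :: "nat \<Rightarrow> nat \<Rightarrow> real"
  where "s_coeff m l = coeff (S_poly m) (l - 1)"

end

theory Submission imports Defs begin

text \<open>Let $R = L/2\pi$ and let \<open>c\<^sub>k\<close> be the Fourier coefficients of the parametrization \<open>z\<close>, where
frequency \<open>k\<close> means \<open>k\<close> turns per period. The whole expression is a diagonal quadratic form in
the \<open>c\<^sub>k\<close>:
\[ E = 2\pi \sum_k \prod_{j=1}^m (k^2 - j^2)\, |c_k|^2 . \]

To see this (\<open>energy_has_sum\<close>), note that the curvature vector has coefficients \<open>-(k/R)\<^sup>2 c\<^sub>k\<close>, so
by Parseval's identity the integral with index \<open>l\<close>, weighted by its power of \<open>R\<close>, is
$2\pi \sum_k k^{2(l-1)} (k^2-1)^2 |c_k|^2$; summed against the \<open>s\<^bsub>m,l\<^esub>\<close> this gives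
$2\pi \sum_k S_m(k^2)(k^2-1)^2|c_k|^2$. In the second part the outward normal is \<open>-\<i> z'\<close>, and
expanding the square in $\int |z - R n|^2$ produces the area, which cancels the area in the
isoperimetric deficit; what remains is $2\pi\sum_k (k^2-1)|c_k|^2$, and its factor is exactly
\<open>P\<^sub>m(1)\<close>. The relation \<open>P\<^sub>m(t) = (t-1) S\<^sub>m(t) + P\<^sub>m(1)\<close> combines the two parts.

The centroid condition says \<open>c\<^sub>0 = 0\<close>, and every weight with \<open>k \<noteq> 0\<close> is nonnegative: it
vanishes for \<open>1 \<le> |k| \<le> m\<close> and is positive beyond. This proves the inequality. In the case of
equality only the frequencies up to \<open>m\<close> survive, so \<open>z'\<close> is a trigonometric polynomial of
constant modulus. Such a polynomial has a single frequency \<open>k\<close>, since the product of its extreme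
coefficients is a nonconstant Fourier coefficient of $|z'|^2$. A simple curve forces \<open>|k| = 1\<close>,
and positive area forces \<open>k = 1\<close>.

Two geometric facts connect the hypotheses with this computation, and both come from writing the
winding number as a Cauchy integral. The winding number is the indicator function of \<open>\<Omega>\<close> off the
curve. Integrating it over a large square and exchanging the integrals expresses the area as a line
integral (\<open>area_by_winding_integral\<close>). And the winding number increases when the curve is crossed from right to left, which
identifies the outward normal (\<open>outward_unit_normal_eq\<close>).\<close>

section \<open>Fourier coefficients and Parseval's identity\<close>

definition fourier_mode :: "real \<Rightarrow> int \<Rightarrow> real \<Rightarrow> complex"
  where "fourier_mode L k s = cis (2 * pi * of_int k * s / L)"

definition fourier_coeff :: "real \<Rightarrow> (real \<Rightarrow> complex) \<Rightarrow> int \<Rightarrow> complex"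
  where "fourier_coeff L f k = integral {0..L} (\<lambda>s. f s * fourier_mode L (- k) s) / of_real L"

lemma fourier_mode_0 [simp]: "fourier_mode L 0 s = 1"
  by (simp add: fourier_mode_def)

lemma norm_fourier_mode [simp]: "norm (fourier_mode L k s) = 1"
  by (simp add: fourier_mode_def)

lemma cnj_fourier_mode: "cnj (fourier_mode L k s) = fourier_mode L (- k) s"
  by (simp add: fourier_mode_def cis_cnj)

lemma fourier_mode_add: "fourier_mode L (j + k) s = fourier_mode L j s * fourier_mode L k s"
  by (simp add: fourier_mode_def cis_mult ring_distribs add_divide_distrib)

lemma fourier_mode_at_0 [simp]: "fourier_mode L k 0 = 1"
  by (simp add: fourier_mode_def)

lemma fourier_mode_at_period [simp]: "L \<noteq> 0 \<Longrightarrow> fourier_mode L k L = 1"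
  using cis_multiple_2pi [of "of_int k"] by (simp add: fourier_mode_def)

lemma fourier_mode_periodic: "L \<noteq> 0 \<Longrightarrow> fourier_mode L k (s + L) = fourier_mode L k s"
  using cis_multiple_2pi [of "of_int k"]
  by (simp add: fourier_mode_def ring_distribs add_divide_distrib flip: cis_mult)

lemma has_vector_derivative_fourier_mode:
  "(fourier_mode L k has_vector_derivative
     \<i> * of_real (2 * pi * of_int k / L) * fourier_mode L k s) (at s within A)"
proof -
  have "((\<lambda>s. cis (c * s)) has_vector_derivative c *\<^sub>R (\<i> * cis (c * s))) (at s within A)" for c
    unfolding has_vector_derivative_def
    by (rule has_derivative_eq_rhs, rule has_derivative_cis, rule has_derivative_mult_right,
        rule has_derivative_ident) (simp add: mult.commute)
  from this [of "2 * pi * of_int k / L"] show ?thesis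
    by (simp add: fourier_mode_def [abs_def] scaleR_conv_of_real mult_ac)
qed

lemma continuous_on_fourier_mode [continuous_intros]: "continuous_on A (fourier_mode L k)"
  using has_vector_derivative_fourier_mode has_vector_derivative_continuous
  by (blast intro: continuous_at_imp_continuous_on)

lemma integral_fourier_mode:
  assumes "L > 0"
  shows "integral {0..L} (fourier_mode L k) = (if k = 0 then of_real L else 0)"
proof (cases "k = 0")
  case True
  then show ?thesis using assms by (simp add: fourier_mode_def[abs_def] scaleR_conv_of_real)
next
  case False
  let ?w = "\<i> * of_real (2 * pi * of_int k / L)"
  have w: "?w \<noteq> 0" using assms False by simp
  have "((\<lambda>s. ?w * fourier_mode L k s) has_integral fourier_mode L k L - fourier_mode L k 0) {0..L}"
    using assms by (intro fundamental_theorem_of_calculus has_vector_derivative_fourier_mode) auto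
  then have "((\<lambda>s. ?w * fourier_mode L k s) has_integral 0) {0..L}"
    using assms by simp
  then have "((\<lambda>s. inverse ?w * (?w * fourier_mode L k s)) has_integral inverse ?w * 0) {0..L}"
    by (rule has_integral_mult_right)
  then show ?thesis
    using w False by (simp add: integral_unique mult.assoc [symmetric])
qed

lemma fourier_coeff_mode_family:
  assumes "L > 0" "finite A"
  shows "fourier_coeff L (\<lambda>s. \<Sum>x\<in>A. a x * fourier_mode L (n x) s) k = (\<Sum>x\<in>A. if n x = k then a x else 0)"
proof -
  have "integral {0..L} (\<lambda>s. (\<Sum>x\<in>A. a x * fourier_mode L (n x) s) * fourier_mode L (- k) s)
      = integral {0..L} (\<lambda>s. \<Sum>x\<in>A. a x * fourier_mode L (n x - k) s)"
    by (simp add: sum_distrib_right mult.assoc fourier_mode_add [symmetric])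
  also have "\<dots> = (\<Sum>x\<in>A. a x * (if n x = k then of_real L else 0))"
    using assms
    by (subst integral_sum)
      (auto intro!: integrable_continuous_interval continuous_intros sum.cong simp: integral_fourier_mode)
  also have "\<dots> = of_real L * (\<Sum>x\<in>A. if n x = k then a x else 0)"
    unfolding sum_distrib_left by (intro sum.cong) auto
  finally show ?thesis
    using assms by (simp add: fourier_coeff_def)
qed

lemma fourier_coeff_mode_sum:
  assumes "L > 0" "finite K"
  shows "fourier_coeff L (\<lambda>s. \<Sum>j\<in>K. a j * fourier_mode L j s) k = (if k \<in> K then a k else 0)"
  using fourier_coeff_mode_family [OF assms, of a "\<lambda>j. j" k] assms(2)
  by simp

lemma fourier_coeff_add:
  assumes "continuous_on {0..L} f" "continuous_on {0..L} g"
  shows "fourier_coeff L (\<lambda>s. f s + g s) k = fourier_coeff L f k + fourier_coeff L g k"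
  unfolding fourier_coeff_def distrib_right
  by (subst integral_add) (auto intro!: integrable_continuous_interval continuous_intros assms
      simp: add_divide_distrib)

lemma fourier_coeff_scaleR: "fourier_coeff L (\<lambda>s. r *\<^sub>R f s) k = of_real r * fourier_coeff L f k"
  unfolding fourier_coeff_def by (simp add: scaleR_conv_of_real mult.assoc)

lemma fourier_coeff_diff:
  assumes "continuous_on {0..L} f" "continuous_on {0..L} g"
  shows "fourier_coeff L (\<lambda>s. f s - g s) k = fourier_coeff L f k - fourier_coeff L g k"
  unfolding fourier_coeff_def left_diff_distrib
  by (subst integral_diff) (auto intro!: integrable_continuous_interval continuous_intros assms
      simp: diff_divide_distrib)

text \<open>Integration by parts; periodicity removes the boundary terms.\<close>

lemma fourier_coeff_derivative:
  assumes L: "L > 0" and per: "f L = f 0"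
    and deriv: "\<And>s. s \<in> {0..L} \<Longrightarrow> (f has_vector_derivative f' s) (at s within {0..L})"
    and cont: "continuous_on {0..L} f'"
  shows "fourier_coeff L f' k = \<i> * of_real (2 * pi * of_int k / L) * fourier_coeff L f k"
proof -
  define w where "w = \<i> * of_real (2 * pi * of_int k / L)"
  let ?e = "fourier_mode L (- k)"
  have cf: "continuous_on {0..L} f"
    using deriv by (rule continuous_on_vector_derivative)
  have "((\<lambda>s. f s * ?e s) has_vector_derivative (f s * (- w * ?e s) + f' s * ?e s))
      (at s within {0..L})" if "s \<in> {0..L}" for s
  proof -
    have "(?e has_vector_derivative - w * ?e s) (at s within {0..L})"
      using has_vector_derivative_fourier_mode [of L "- k"] by (rule has_vector_derivative_eq_rhs) (simp add: w_def)
    from has_vector_derivative_mult [OF deriv [OF that] this] show ?thesis .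
  qed
  then have "((\<lambda>s. f s * (- w * ?e s) + f' s * ?e s) has_integral f L * ?e L - f 0 * ?e 0) {0..L}"
    using L by (intro fundamental_theorem_of_calculus) auto
  then have "integral {0..L} (\<lambda>s. f s * (- w * ?e s) + f' s * ?e s) = 0"
    using per L by (simp add: integral_unique)
  moreover have "integral {0..L} (\<lambda>s. f s * (- w * ?e s) + f' s * ?e s)
      = integral {0..L} (\<lambda>s. (- w) * (f s * ?e s)) + integral {0..L} (\<lambda>s. f' s * ?e s)"
    by (subst integral_add [symmetric])
      (auto intro!: integrable_continuous_interval continuous_intros cf cont simp: mult_ac)
  moreover have "integral {0..L} (\<lambda>s. (- w) * (f s * ?e s)) = (- w) * integral {0..L} (\<lambda>s. f s * ?e s)"
    by (rule integral_mult_right)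
  ultimately have "integral {0..L} (\<lambda>s. f' s * ?e s) = w * integral {0..L} (\<lambda>s. f s * ?e s)"
    by (simp add: add_eq_0_iff2)
  then show ?thesis
    by (simp add: fourier_coeff_def w_def)
qed

definition trig_polynomial :: "real \<Rightarrow> (real \<Rightarrow> complex) \<Rightarrow> bool"
  where "trig_polynomial L p \<longleftrightarrow>
    (\<exists>K a. finite K \<and> p = (\<lambda>s. \<Sum>k\<in>K. a k * fourier_mode L k s))"

lemma trig_polynomial_mode: "trig_polynomial L (\<lambda>s. c * fourier_mode L k s)"
  unfolding trig_polynomial_def by (rule exI [of _ "{k}"], rule exI [of _ "\<lambda>_. c"]) simp

lemma trig_polynomial_const: "trig_polynomial L (\<lambda>s. c)"
  using trig_polynomial_mode [of L c 0] by simp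

lemma trig_polynomial_add:
  assumes "trig_polynomial L p" "trig_polynomial L q"
  shows "trig_polynomial L (\<lambda>s. p s + q s)"
proof -
  obtain K a where K: "finite K" "p = (\<lambda>s. \<Sum>k\<in>K. a k * fourier_mode L k s)"
    using assms(1) unfolding trig_polynomial_def by blast
  obtain J b where J: "finite J" "q = (\<lambda>s. \<Sum>k\<in>J. b k * fourier_mode L k s)"
    using assms(2) unfolding trig_polynomial_def by blast
  have p: "p s = (\<Sum>k\<in>K \<union> J. (if k \<in> K then a k else 0) * fourier_mode L k s)" for s
    unfolding K(2) using K(1) J(1) by (intro sum.mono_neutral_cong_left) auto
  have q: "q s = (\<Sum>k\<in>K \<union> J. (if k \<in> J then b k else 0) * fourier_mode L k s)" for s
    unfolding J(2) using K(1) J(1) by (intro sum.mono_neutral_cong_left) auto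
  have "(\<lambda>s. p s + q s) = (\<lambda>s. \<Sum>k\<in>K \<union> J.
      ((if k \<in> K then a k else 0) + (if k \<in> J then b k else 0)) * fourier_mode L k s)"
    unfolding p q by (simp add: sum.distrib [symmetric] distrib_right)
  then show ?thesis
    unfolding trig_polynomial_def using K(1) J(1) by (intro exI conjI) (rule finite_UnI, assumption+)
qed

lemma trig_polynomial_sum:
  assumes "finite A" "\<And>x. x \<in> A \<Longrightarrow> trig_polynomial L (p x)"
  shows "trig_polynomial L (\<lambda>s. \<Sum>x\<in>A. p x s)"
  using assms by (induction A rule: finite_induct) (auto intro: trig_polynomial_const trig_polynomial_add)

lemma trig_polynomial_mult:
  assumes "trig_polynomial L p" "trig_polynomial L q"
  shows "trig_polynomial L (\<lambda>s. p s * q s)"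
proof -
  obtain K a where K: "finite K" "p = (\<lambda>s. \<Sum>k\<in>K. a k * fourier_mode L k s)"
    using assms(1) unfolding trig_polynomial_def by blast
  obtain J b where J: "finite J" "q = (\<lambda>s. \<Sum>k\<in>J. b k * fourier_mode L k s)"
    using assms(2) unfolding trig_polynomial_def by blast
  have "(\<lambda>s. p s * q s) = (\<lambda>s. \<Sum>k\<in>K. \<Sum>j\<in>J. (a k * b j) * fourier_mode L (k + j) s)"
    unfolding K J by (simp add: sum_product fourier_mode_add mult_ac)
  then show ?thesis
    using K(1) J(1) by (auto intro!: trig_polynomial_sum trig_polynomial_mode)
qed

text \<open>On the unit circle both coordinates are combinations of the modes of frequency \<open>1\<close> and \<open>-1\<close>,
so the algebra they generate consists of trigonometric polynomials.\<close>

lemma trig_polynomial_of_real_polynomial: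
  assumes "real_polynomial_function g"
  shows "trig_polynomial L (\<lambda>s. of_real (g (fourier_mode L 1 s)))"
  using assms
proof (induction rule: real_polynomial_function.induct)
  case (linear f)
  interpret f: bounded_linear f by fact
  have re: "complex_of_real (Re w) = w / 2 + cnj w / 2" for w
    by (simp add: complex_eq_iff)
  have im: "complex_of_real (Im w) = (- \<i> / 2) * w + (\<i> / 2) * cnj w" for w
    by (simp add: complex_eq_iff)
  define \<alpha> \<beta> where "\<alpha> = complex_of_real (f 1)" and "\<beta> = complex_of_real (f \<i>)"
  have f: "of_real (f w) = (\<alpha> / 2 - \<i> * \<beta> / 2) * w + (\<alpha> / 2 + \<i> * \<beta> / 2) * cnj w" for w
  proof -
    have "f w = f (Re w *\<^sub>R 1 + Im w *\<^sub>R \<i>)"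
      by (rule arg_cong [of _ _ f]) (simp add: complex_eq_iff)
    then have "f w = Re w * f 1 + Im w * f \<i>"
      by (simp only: f.add f.scaleR real_scaleR_def)
    then have "of_real (f w) = of_real (Re w) * \<alpha> + of_real (Im w) * \<beta>"
      by (simp add: \<alpha>_def \<beta>_def)
    then show ?thesis
      by (simp only: re im) (simp add: algebra_simps)
  qed
  show ?case
    unfolding f cnj_fourier_mode by (intro trig_polynomial_add trig_polynomial_mode)
qed (auto intro: trig_polynomial_const trig_polynomial_add trig_polynomial_mult)

lemma trig_polynomial_of_polynomial_function:
  fixes g :: "complex \<Rightarrow> complex"
  assumes "polynomial_function g"
  shows "trig_polynomial L (\<lambda>s. g (fourier_mode L 1 s))"
proof -
  have "real_polynomial_function (Re \<circ> g)" "real_polynomial_function (Im \<circ> g)"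
    using assms bounded_linear_Re bounded_linear_Im unfolding polynomial_function_def by blast+
  from this [THEN trig_polynomial_of_real_polynomial, of L]
  have "trig_polynomial L (\<lambda>s. of_real (Re (g (fourier_mode L 1 s))) + \<i> * of_real (Im (g (fourier_mode L 1 s))))"
    by (intro trig_polynomial_add trig_polynomial_mult trig_polynomial_const) simp_all
  then show ?thesis by (simp flip: complex_eq)
qed

text \<open>Passing to the circle turns periodic approximation into approximation on a compact set, where the
Stone--Weierstrass theorem applies.\<close>

lemma continuous_on_circle_of_periodic:
  fixes f :: "real \<Rightarrow> complex"
  assumes L: "L > 0" and cont: "continuous_on UNIV f" and per: "\<And>s. f (s + L) = f s"
  obtains g where "continuous_on (sphere 0 1) g" "\<And>s. s \<in> {0..L} \<Longrightarrow> g (fourier_mode L 1 s) = f s"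
proof -
  define h where "h x = f (L / (2 * pi) * x)" for x
  have h: "continuous_on UNIV h"
    unfolding h_def by (intro continuous_on_compose2 [OF cont] continuous_intros) auto
  have hper: "h (x + 2 * pi) = h x" for x
    unfolding h_def using per [of "L / (2 * pi) * x"] by (simp add: field_simps)
  define g where "g = (\<lambda>w. h (Arg2pi w))"
  have "isCont g w" if w: "norm w = 1" for w
  proof (cases "w \<in> \<real>\<^sub>\<ge>\<^sub>0")
    case False
    then show ?thesis unfolding g_def
      using h continuous_at_Arg2pi continuous_at_compose [of w Arg2pi h]
      by (simp add: o_def continuous_on_eq_continuous_at)
  next
    case True
    \<comment> \<open>Here the principal argument is the continuous branch, and \<open>h\<close> does not see the difference.\<close>
    have nw: "w \<notin> \<real>\<^sub>\<le>\<^sub>0"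
      using True w by (auto simp: complex_nonneg_Reals_iff complex_nonpos_Reals_iff cmod_eq_Re)
    have eq: "h (Arg2pi v) = h (Arg v)" if "v \<noteq> 0" for v
    proof (cases "0 \<le> Arg v")
      case True
      then have "Arg2pi v = Arg v"
        using that Arg_eq [of v] Arg_le_pi [of v] pi_gt_zero
        by (intro Arg2pi_unique [of "norm v"]) (auto simp del: pi_gt_zero)
      then show ?thesis by simp
    next
      case False
      have "exp (\<i> * of_real (Arg v + 2 * pi)) = exp (\<i> * of_real (Arg v))"
        unfolding cis_conv_exp [symmetric] by (simp add: cis.ctr)
      then have "Arg2pi v = Arg v + 2 * pi"
        using that False Arg_eq [of v] mpi_less_Arg [of v]
        by (intro Arg2pi_unique [of "norm v"]) auto
      then show ?thesis using hper by simp
    qed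
    have "isCont (\<lambda>v. h (Arg v)) w"
      using h continuous_at_Arg [OF nw] continuous_at_compose [of w Arg h]
      by (simp add: o_def continuous_on_eq_continuous_at)
    moreover have "\<forall>\<^sub>F v in nhds w. h (Arg2pi v) = h (Arg v)"
    proof -
      have "\<forall>\<^sub>F v in nhds w. v \<noteq> 0"
        using w by (intro t1_space_nhds) auto
      then show ?thesis by (rule eventually_mono) (rule eq)
    qed
    ultimately show ?thesis
      unfolding g_def by (simp add: isCont_cong)
  qed
  then have "continuous_on (sphere 0 1) g"
    by (auto simp: continuous_at_imp_continuous_on)
  moreover have "g (fourier_mode L 1 s) = f s" if "s \<in> {0..L}" for s
  proof (cases "s = L")
    case True
    moreover have "Arg2pi 1 = 0" using Arg2pi_of_real [of 1] by simp
    ultimately show ?thesis using L per [of 0] by (simp add: g_def h_def)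
  next
    case False
    have "Arg2pi (fourier_mode L 1 s) = 2 * pi * s / L"
      using that False L unfolding fourier_mode_def cis_conv_exp
      by (subst Arg2pi_exp) (auto simp: field_simps)
    then show ?thesis using L by (simp add: g_def h_def)
  qed
  ultimately show ?thesis using that by blast
qed

lemma trig_polynomial_dense:
  fixes f :: "real \<Rightarrow> complex"
  assumes L: "L > 0" and cont: "continuous_on UNIV f" and per: "\<And>s. f (s + L) = f s" and "\<epsilon> > 0"
  obtains p where "trig_polynomial L p" "\<And>s. s \<in> {0..L} \<Longrightarrow> norm (f s - p s) < \<epsilon>"
proof -
  obtain g where g: "continuous_on (sphere 0 1) g" "\<And>s. s \<in> {0..L} \<Longrightarrow> g (fourier_mode L 1 s) = f s"
    using continuous_on_circle_of_periodic [OF L cont per] by blast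
  obtain q where q: "polynomial_function q" "\<forall>w \<in> sphere 0 1. norm (g w - q w) < \<epsilon>"
    using Stone_Weierstrass_polynomial_function [OF compact_sphere g(1) \<open>\<epsilon> > 0\<close>] by blast
  show ?thesis
  proof
    show "trig_polynomial L (\<lambda>s. q (fourier_mode L 1 s))"
      by (rule trig_polynomial_of_polynomial_function [OF q(1)])
    show "norm (f s - q (fourier_mode L 1 s)) < \<epsilon>" if "s \<in> {0..L}" for s
      using q(2) g(2) [OF that] by (metis dist_0_norm mem_sphere norm_fourier_mode)
  qed
qed

text \<open>Orthogonality of the modes: among the trigonometric polynomials with frequencies in \<open>K\<close>, the one
with the Fourier coefficients is the closest. Both halves of Parseval's identity follow from this
expansion, Bessel's inequality by taking \<open>a\<close> to be the Fourier coefficients, completeness by taking a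
uniform approximation.\<close>

lemma integral_norm_diff_trig_polynomial:
  assumes L: "L > 0" and cont: "continuous_on {0..L} f" and K: "finite K"
  shows "integral {0..L} (\<lambda>s. (norm (f s - (\<Sum>k\<in>K. a k * fourier_mode L k s)))\<^sup>2)
    = integral {0..L} (\<lambda>s. (norm (f s))\<^sup>2)
      + L * (\<Sum>k\<in>K. (norm (a k - fourier_coeff L f k))\<^sup>2 - (norm (fourier_coeff L f k))\<^sup>2)"
proof -
  let ?p = "\<lambda>s. \<Sum>k\<in>K. a k * fourier_mode L k s"
  let ?c = "fourier_coeff L f"
  note int = integrable_continuous_interval continuous_intros cont
  have cp: "continuous_on {0..L} ?p" by (intro continuous_intros)
  have fp: "integral {0..L} (\<lambda>s. f s * cnj (?p s)) = of_real L * (\<Sum>k\<in>K. cnj (a k) * ?c k)"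
  proof -
    have "integral {0..L} (\<lambda>s. f s * cnj (?p s))
        = integral {0..L} (\<lambda>s. \<Sum>k\<in>K. cnj (a k) * (f s * fourier_mode L (- k) s))"
      by (simp add: sum_distrib_left cnj_fourier_mode mult_ac)
    also have "\<dots> = (\<Sum>k\<in>K. cnj (a k) * integral {0..L} (\<lambda>s. f s * fourier_mode L (- k) s))"
      using K by (subst integral_sum) (auto intro!: int)
    finally show ?thesis
      using L by (simp add: fourier_coeff_def sum_distrib_left)
  qed
  have pf: "integral {0..L} (\<lambda>s. ?p s * cnj (f s)) = cnj (of_real L * (\<Sum>k\<in>K. cnj (a k) * ?c k))"
    by (subst fp [symmetric], subst integral_cnj) (simp add: mult_ac)
  have pp: "integral {0..L} (\<lambda>s. ?p s * cnj (?p s)) = of_real L * (\<Sum>k\<in>K. a k * cnj (a k))"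
  proof -
    have "integral {0..L} (\<lambda>s. ?p s * cnj (?p s))
        = integral {0..L} (\<lambda>s. \<Sum>k\<in>K. cnj (a k) * (?p s * fourier_mode L (- k) s))"
      by (simp add: sum_distrib_left cnj_fourier_mode mult_ac)
    also have "\<dots> = (\<Sum>k\<in>K. cnj (a k) * integral {0..L} (\<lambda>s. ?p s * fourier_mode L (- k) s))"
      using K by (subst integral_sum) (auto intro!: int)
    also have "\<dots> = (\<Sum>k\<in>K. cnj (a k) * (of_real L * fourier_coeff L ?p k))"
      using L by (simp add: fourier_coeff_def)
    also have "\<dots> = of_real L * (\<Sum>k\<in>K. a k * cnj (a k))"
      using fourier_coeff_mode_sum [OF L K, of a] by (simp add: sum_distrib_left mult_ac)
    finally show ?thesis .
  qed
  have sq: "integral {0..L} (\<lambda>s. (norm (g s))\<^sup>2) = Re (integral {0..L} (\<lambda>s. g s * cnj (g s)))"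
    if "continuous_on {0..L} g" for g :: "real \<Rightarrow> complex"
  proof -
    have "complex_of_real (integral {0..L} (\<lambda>s. (norm (g s))\<^sup>2))
        = integral {0..L} (\<lambda>s. complex_of_real ((norm (g s))\<^sup>2))"
      using that by (intro has_integral_of_real [THEN integral_unique, symmetric] integrable_integral int)
    then show ?thesis by (simp add: complex_norm_square flip: of_real_power) (metis Re_complex_of_real)
  qed
  have split: "integral {0..L} (\<lambda>s. (f s - ?p s) * cnj (f s - ?p s))
      = integral {0..L} (\<lambda>s. f s * cnj (f s)) - integral {0..L} (\<lambda>s. f s * cnj (?p s))
        - integral {0..L} (\<lambda>s. ?p s * cnj (f s)) + integral {0..L} (\<lambda>s. ?p s * cnj (?p s))"
  proof -
    have "(\<lambda>s. (f s - ?p s) * cnj (f s - ?p s))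
      = (\<lambda>s. f s * cnj (f s) - f s * cnj (?p s) - ?p s * cnj (f s) + ?p s * cnj (?p s))"
      by (simp add: algebra_simps)
    moreover have "integral {0..L} (\<lambda>s. f s * cnj (f s) - f s * cnj (?p s) - ?p s * cnj (f s) + ?p s * cnj (?p s))
      = integral {0..L} (\<lambda>s. f s * cnj (f s)) - integral {0..L} (\<lambda>s. f s * cnj (?p s))
        - integral {0..L} (\<lambda>s. ?p s * cnj (f s)) + integral {0..L} (\<lambda>s. ?p s * cnj (?p s))"
      by (subst integral_add integral_diff, (intro int integrable_add integrable_diff cp)+)+ simp
    ultimately show ?thesis by simp
  qed
  have "Re (integral {0..L} (\<lambda>s. (f s - ?p s) * cnj (f s - ?p s)))
      = integral {0..L} (\<lambda>s. (norm (f s))\<^sup>2)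
      + L * (\<Sum>k\<in>K. (norm (a k - ?c k))\<^sup>2 - (norm (?c k))\<^sup>2)"
    unfolding split fp pf pp sq [OF cont]
    unfolding cmod_power2
    by (simp add: power2_eq_square algebra_simps sum_distrib_left sum.distrib sum_subtractf)
  then show ?thesis
    by (simp only: sq [OF continuous_on_diff [OF cont cp]])
qed

theorem parseval:
  fixes f :: "real \<Rightarrow> complex"
  assumes L: "L > 0" and cont: "continuous_on UNIV f" and per: "\<And>s. f (s + L) = f s"
  shows "((\<lambda>k. L * (norm (fourier_coeff L f k))\<^sup>2) has_sum integral {0..L} (\<lambda>s. (norm (f s))\<^sup>2)) UNIV"
proof -
  let ?c = "fourier_coeff L f" and ?I = "integral {0..L} (\<lambda>s. (norm (f s))\<^sup>2)"
  have contL: "continuous_on {0..L} f" using cont continuous_on_subset by blast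
  note expand = integral_norm_diff_trig_polynomial [OF L contL]
  have upper: "L * (\<Sum>k\<in>K. (norm (?c k))\<^sup>2) \<le> ?I" if K: "finite K" for K
  proof -
    have "0 \<le> integral {0..L} (\<lambda>s. (norm (f s - (\<Sum>k\<in>K. ?c k * fourier_mode L k s)))\<^sup>2)"
      by (intro integral_nonneg integrable_continuous_interval continuous_intros contL) simp
    also have "\<dots> = ?I - L * (\<Sum>k\<in>K. (norm (?c k))\<^sup>2)"
      by (simp add: expand K sum_negf)
    finally show ?thesis by simp
  qed
  have lower: "\<exists>K. finite K \<and> ?I - L * \<epsilon>\<^sup>2 \<le> L * (\<Sum>k\<in>K. (norm (?c k))\<^sup>2)" if \<epsilon>: "\<epsilon> > 0" for \<epsilon>
  proof -
    obtain p where p: "trig_polynomial L p" "\<And>s. s \<in> {0..L} \<Longrightarrow> norm (f s - p s) < \<epsilon>"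
      using trig_polynomial_dense [OF L cont per \<epsilon>] by blast
    then obtain K a where K: "finite K" "p = (\<lambda>s. \<Sum>k\<in>K. a k * fourier_mode L k s)"
      unfolding trig_polynomial_def by blast
    have "integral {0..L} (\<lambda>s. (norm (f s - p s))\<^sup>2) \<le> integral {0..L} (\<lambda>s. \<epsilon>\<^sup>2)"
      using p(2) unfolding K(2)
      by (intro integral_le integrable_continuous_interval continuous_intros contL power_mono) (auto intro: less_imp_le)
    also have "\<dots> = L * \<epsilon>\<^sup>2" using L by simp
    finally have "?I + L * (\<Sum>k\<in>K. (norm (a k - ?c k))\<^sup>2 - (norm (?c k))\<^sup>2) \<le> L * \<epsilon>\<^sup>2"
      using expand [OF K(1), of a] unfolding K(2) by simp
    moreover have "0 \<le> L * (\<Sum>k\<in>K. (norm (a k - ?c k))\<^sup>2)"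
      using L by (intro mult_nonneg_nonneg sum_nonneg) auto
    ultimately have "?I - L * \<epsilon>\<^sup>2 \<le> L * (\<Sum>k\<in>K. (norm (?c k))\<^sup>2)"
      by (simp add: sum_subtractf algebra_simps)
    then show ?thesis using K(1) by blast
  qed
  show ?thesis
    unfolding has_sum_def
  proof (rule order_tendstoI)
    fix x assume x: "x < ?I"
    \<comment> \<open>An approximation within \<open>\<epsilon>\<close> loses at most \<open>L \<epsilon>\<^sup>2\<close>, here half of the available gap.\<close>
    define \<epsilon> where "\<epsilon> = sqrt ((?I - x) / (2 * L))"
    have \<epsilon>: "\<epsilon> > 0" "L * \<epsilon>\<^sup>2 = (?I - x) / 2"
      using x L by (auto simp: \<epsilon>_def)
    obtain K where K: "finite K" "?I - L * \<epsilon>\<^sup>2 \<le> L * (\<Sum>k\<in>K. (norm (?c k))\<^sup>2)"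
      using lower [OF \<epsilon>(1)] by blast
    show "\<forall>\<^sub>F A in finite_subsets_at_top UNIV. x < (\<Sum>k\<in>A. L * (norm (?c k))\<^sup>2)"
      unfolding eventually_finite_subsets_at_top
    proof (intro exI conjI allI impI)
      fix A assume A: "finite A \<and> K \<subseteq> A \<and> A \<subseteq> (UNIV :: int set)"
      have "x < ?I - L * \<epsilon>\<^sup>2" using x \<epsilon>(2) by simp
      also have "\<dots> \<le> (\<Sum>k\<in>K. L * (norm (?c k))\<^sup>2)" using K(2) by (simp add: sum_distrib_left)
      also have "\<dots> \<le> (\<Sum>k\<in>A. L * (norm (?c k))\<^sup>2)" using A L by (intro sum_mono2) auto
      finally show "x < (\<Sum>k\<in>A. L * (norm (?c k))\<^sup>2)" .
    qed (use K in auto)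
  next
    fix x assume x: "?I < x"
    show "\<forall>\<^sub>F A in finite_subsets_at_top UNIV. (\<Sum>k\<in>A. L * (norm (?c k))\<^sup>2) < x"
      using upper x by (intro eventually_finite_subsets_at_top_weakI) (force simp: sum_distrib_left)
  qed
qed

lemma eq_0_if_fourier_coeffs_0:
  fixes f :: "real \<Rightarrow> complex"
  assumes L: "L > 0" and cont: "continuous_on UNIV f" and per: "\<And>s. f (s + L) = f s"
    and zero: "\<And>k. fourier_coeff L f k = 0"
  shows "f s = 0"
proof -
  have "((\<lambda>k::int. 0) has_sum integral {0..L} (\<lambda>s. (norm (f s))\<^sup>2)) UNIV"
    using parseval [OF L cont per] by (simp add: zero)
  then have "integral {0..L} (\<lambda>s. (norm (f s))\<^sup>2) = 0"
    using has_sum_0_simp has_sum_unique by blast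
  moreover have c: "continuous_on (cbox 0 L) (\<lambda>s. (norm (f s))\<^sup>2)"
    using cont by (auto intro!: continuous_intros intro: continuous_on_subset)
  ultimately have "((\<lambda>s. (norm (f s))\<^sup>2) has_integral 0) (cbox 0 L)"
    by (metis cbox_interval has_integral_integral integrable_continuous)
  with c have period: "f r = 0" if "r \<in> {0..L}" for r
    using L that has_integral_0_cbox_imp_0 [of 0 L "\<lambda>s. (norm (f s))\<^sup>2" r] by auto
  have shift: "f (r + of_int n * L) = f r" for r n
  proof (induction n rule: int_induct [where k = 0])
    case (step1 i)
    then show ?case using per [of "r + of_int i * L"] by (simp add: algebra_simps)
  next
    case (step2 i)
    then show ?case using per [of "r + of_int (i - 1) * L"] by (simp add: algebra_simps)
  qed simp
  have "frac (s / L) * L + of_int \<lfloor>s / L\<rfloor> * L = s"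
    using L by (simp add: frac_def left_diff_distrib)
  then have "f s = f (frac (s / L) * L)"
    using shift by metis
  also have "\<dots> = 0"
    using L frac_lt_1 [of "s / L"] frac_ge_0 [of "s / L"] by (intro period) (auto simp: mult_le_cancel_right1)
  finally show ?thesis .
qed

section \<open>Iterated derivatives and their Fourier coefficients\<close>

lemma iterated_derivative_0 [simp]: "iterated_derivative 0 f = f"
  by (simp add: iterated_derivative_def)

lemma iterated_derivative_Suc:
  "iterated_derivative (Suc k) f = (\<lambda>s. vector_derivative (iterated_derivative k f) (at s))"
  by (simp add: iterated_derivative_def)

lemma Ck_has_vector_derivative:
  assumes "Ck m f" "k < m"
  shows "(iterated_derivative k f has_vector_derivative iterated_derivative (Suc k) f s) (at s)"
  using assms unfolding Ck_def iterated_derivative_Suc by (simp add: vector_derivative_works)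

lemma Ck_continuous:
  assumes "Ck m f" "k \<le> m"
  shows "continuous_on UNIV (iterated_derivative k f)"
proof (cases "k = m")
  case False
  then show ?thesis
    using Ck_has_vector_derivative [OF assms(1), of k] assms(2)
    by (intro continuous_on_vector_derivative) auto
qed (use assms in \<open>simp add: Ck_def\<close>)

lemma iterated_derivative_periodic:
  assumes "Ck m f" "\<And>s. f (s + L) = f s" "k \<le> m"
  shows "iterated_derivative k f (s + L) = iterated_derivative k f s"
  using assms(3)
proof (induction k arbitrary: s)
  case (Suc k)
  let ?g = "iterated_derivative k f"
  note d = Ck_has_vector_derivative [OF assms(1), of k]
  have "((\<lambda>s. s + L) has_vector_derivative 1) (at s)"
    by (auto intro!: derivative_eq_intros)
  from vector_diff_chain_at [OF this d]
  have "(?g \<circ> (\<lambda>s. s + L) has_vector_derivative iterated_derivative (Suc k) f (s + L)) (at s)"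
    using Suc.prems by simp
  moreover have "?g \<circ> (\<lambda>s. s + L) = ?g"
    using Suc by (auto simp: fun_eq_iff)
  ultimately show ?case
    using d [of s] Suc.prems vector_derivative_unique_at by (metis Suc_le_lessD)
qed (use assms in simp)

text \<open>The expression needs derivatives of the vector field $z + R^2\kappa$ itself. As derivatives are
total functions, linearity is available only up to the order for which \<open>f\<close> is smooth enough.\<close>

lemma iterated_derivative_add_second:
  assumes "Ck m f" "k + 2 \<le> m"
  shows "iterated_derivative k (\<lambda>r. f r + c *\<^sub>R iterated_derivative 2 f r)
    = (\<lambda>s. iterated_derivative k f s + c *\<^sub>R iterated_derivative (k + 2) f s)"
  using assms(2)
proof (induction k)
  case (Suc k)
  have d: "((\<lambda>s. iterated_derivative k f s + c *\<^sub>R iterated_derivative (k + 2) f s) has_vector_derivative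
      iterated_derivative (Suc k) f s + c *\<^sub>R iterated_derivative (Suc (k + 2)) f s) (at s)" for s
    using Suc.prems
    by (intro has_vector_derivative_add bounded_linear.has_vector_derivative [OF bounded_linear_scaleR_right]
        Ck_has_vector_derivative [OF assms(1)]) auto
  have IH: "iterated_derivative k (\<lambda>r. f r + c *\<^sub>R iterated_derivative 2 f r)
      = (\<lambda>s. iterated_derivative k f s + c *\<^sub>R iterated_derivative (k + 2) f s)"
    using Suc by simp
  show ?case
    unfolding iterated_derivative_Suc [of k "\<lambda>r. f r + c *\<^sub>R iterated_derivative 2 f r"] IH
    by (simp only: vector_derivative_at [OF d] add_Suc)
qed (simp add: numeral_2_eq_2)

lemma fourier_coeff_iterated_derivative:
  assumes L: "L > 0" and f: "Ck m f" and per: "\<And>s. f (s + L) = f s" and "k \<le> m"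
  shows "fourier_coeff L (iterated_derivative k f) n = (\<i> * of_real (2 * pi * of_int n / L)) ^ k * fourier_coeff L f n"
  using \<open>k \<le> m\<close>
proof (induction k)
  case (Suc k)
  have "fourier_coeff L (iterated_derivative (Suc k) f) n
      = \<i> * of_real (2 * pi * of_int n / L) * fourier_coeff L (iterated_derivative k f) n"
  proof (rule fourier_coeff_derivative [OF L])
    show "iterated_derivative k f L = iterated_derivative k f 0"
      using iterated_derivative_periodic [OF f per, of k 0] Suc.prems by simp
    show "(iterated_derivative k f has_vector_derivative iterated_derivative (Suc k) f s) (at s within {0..L})" for s
      using Suc.prems by (intro has_vector_derivative_at_within [OF Ck_has_vector_derivative [OF f]]) simp
    show "continuous_on {0..L} (iterated_derivative (Suc k) f)"
      using Ck_continuous [OF f Suc.prems] by (rule continuous_on_subset) simp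
  qed
  then show ?case using Suc by simp
qed simp

lemma parseval_iterated_derivative:
  fixes f :: "real \<Rightarrow> complex"
  assumes L: "L > 0" and f: "Ck m f" and per: "\<And>s. f (s + L) = f s" and k: "k \<le> m"
  shows "((\<lambda>n. L * ((2 * pi * of_int n / L)\<^sup>2) ^ k * (norm (fourier_coeff L f n))\<^sup>2)
    has_sum integral {0..L} (\<lambda>s. (norm (iterated_derivative k f s))\<^sup>2)) UNIV"
proof -
  have "L * (norm (fourier_coeff L (iterated_derivative k f) n))\<^sup>2
      = L * ((2 * pi * of_int n / L)\<^sup>2) ^ k * (norm (fourier_coeff L f n))\<^sup>2" for n
  proof -
    have "(norm (fourier_coeff L (iterated_derivative k f) n))\<^sup>2
        = (\<bar>2 * pi * of_int n / L\<bar> ^ k)\<^sup>2 * (norm (fourier_coeff L f n))\<^sup>2"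
      unfolding fourier_coeff_iterated_derivative [OF L f per k] norm_mult norm_power norm_of_real
      by (simp add: power_mult_distrib)
    also have "(\<bar>2 * pi * of_int n / L\<bar> ^ k)\<^sup>2 = ((2 * pi * of_int n / L)\<^sup>2) ^ k"
      by (metis power2_abs power_mult mult.commute)
    finally show ?thesis by simp
  qed
  with parseval [OF L Ck_continuous [OF f k] iterated_derivative_periodic [OF f per k]]
  show ?thesis by (simp only:)
qed

text \<open>The operator $1 + R^2 d^2/ds^2$ multiplies the coefficient of frequency \<open>n\<close> by \<open>1 - n\<^sup>2\<close>, so it
annihilates exactly the frequencies \<open>1\<close> and \<open>-1\<close>.\<close>

lemma parseval_second_order_defect:
  fixes f :: "real \<Rightarrow> complex"
  assumes L: "L > 0" and f: "Ck m f" and per: "\<And>s. f (s + L) = f s" and k: "k + 2 \<le> m"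
  shows "((\<lambda>n. L * ((2 * pi * of_int n / L)\<^sup>2) ^ k * (((of_int n)\<^sup>2 - 1)\<^sup>2 * (norm (fourier_coeff L f n))\<^sup>2))
    has_sum integral {0..L} (\<lambda>s. (norm (iterated_derivative k
      (\<lambda>r. f r + (L / (2 * pi))\<^sup>2 *\<^sub>R curvature_vector f r) s))\<^sup>2)) UNIV"
proof -
  let ?R = "L / (2 * pi)"
  let ?g = "iterated_derivative k (\<lambda>r. f r + ?R\<^sup>2 *\<^sub>R curvature_vector f r)"
  have g: "?g = (\<lambda>s. iterated_derivative k f s + ?R\<^sup>2 *\<^sub>R iterated_derivative (k + 2) f s)"
    unfolding curvature_vector_def by (rule iterated_derivative_add_second [OF f k])
  have k': "k \<le> m" using k by simp
  have cont: "continuous_on A (iterated_derivative k f)" "continuous_on A (iterated_derivative (k + 2) f)" for A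
    using Ck_continuous [OF f k] Ck_continuous [OF f k'] continuous_on_subset by blast+
  have coeff: "fourier_coeff L ?g n = (\<i> * of_real (2 * pi * of_int n / L)) ^ k * (of_real (1 - (of_int n)\<^sup>2) * fourier_coeff L f n)" for n
  proof -
    let ?w = "\<i> * of_real (2 * pi * of_int n / L) :: complex"
    have "fourier_coeff L ?g n = ?w ^ k * fourier_coeff L f n + of_real (?R\<^sup>2) * (?w ^ (k + 2) * fourier_coeff L f n)"
      unfolding g
      by (subst fourier_coeff_add)
        (auto intro!: continuous_intros cont simp: fourier_coeff_scaleR fourier_coeff_iterated_derivative [OF L f per] k k' simp del: power_Suc add_2_eq_Suc')
    also have "\<dots> = ?w ^ k * ((1 + of_real (?R\<^sup>2) * ?w\<^sup>2) * fourier_coeff L f n)"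
      by (simp only: power_add) (simp only: algebra_simps mult_1_left)
    also have "1 + of_real (?R\<^sup>2) * ?w\<^sup>2 = (of_real (1 - (of_int n)\<^sup>2) :: complex)"
    proof -
      have "of_real (?R\<^sup>2) * ?w\<^sup>2 = - of_real (?R\<^sup>2 * (2 * pi * of_int n / L)\<^sup>2)"
        by (simp only: power_mult_distrib i_squared of_real_mult of_real_power) simp
      also have "?R\<^sup>2 * (2 * pi * of_int n / L)\<^sup>2 = (of_int n)\<^sup>2"
        using L by (simp add: power_divide power_mult_distrib)
      finally show ?thesis by simp
    qed
    finally show ?thesis .
  qed
  have "L * (norm (fourier_coeff L ?g n))\<^sup>2
      = L * ((2 * pi * of_int n / L)\<^sup>2) ^ k * (((of_int n)\<^sup>2 - 1)\<^sup>2 * (norm (fourier_coeff L f n))\<^sup>2)" for n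
  proof -
    have "(norm (fourier_coeff L ?g n))\<^sup>2
        = (\<bar>2 * pi * of_int n / L\<bar> ^ k)\<^sup>2 * (\<bar>1 - (real_of_int n)\<^sup>2\<bar>\<^sup>2 * (norm (fourier_coeff L f n))\<^sup>2)"
      unfolding coeff norm_mult norm_power norm_of_real by (simp add: power_mult_distrib)
    also have "(\<bar>2 * pi * of_int n / L\<bar> ^ k)\<^sup>2 = ((2 * pi * of_int n / L)\<^sup>2) ^ k"
      by (metis power2_abs power_mult mult.commute)
    also have "\<bar>1 - (real_of_int n)\<^sup>2\<bar>\<^sup>2 = ((of_int n)\<^sup>2 - 1)\<^sup>2"
      by (simp add: power2_commute)
    finally show ?thesis by simp
  qed
  moreover have "((\<lambda>n. L * (norm (fourier_coeff L ?g n))\<^sup>2) has_sum integral {0..L} (\<lambda>s. (norm (?g s))\<^sup>2)) UNIV"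
  proof (rule parseval [OF L])
    show "continuous_on UNIV ?g"
      unfolding g by (intro continuous_intros cont)
    show "?g (s + L) = ?g s" for s
      unfolding g using iterated_derivative_periodic [OF f per] k k' by simp
  qed
  ultimately show ?thesis by (simp only:)
qed

section \<open>The Cauchy kernel on a square\<close>

text \<open>Fubini's theorem on the complex plane needs Lebesgue measure there as a product measure.\<close>

lemma lborel_complex:
  "lborel = distr (lborel \<Otimes>\<^sub>M lborel) borel (\<lambda>(x, y). Complex x y)" (is "_ = ?D")
proof (rule lborel_eqI)
  have meas [measurable]: "(\<lambda>(x, y). Complex x y) \<in> borel_measurable (lborel \<Otimes>\<^sub>M lborel)"
    unfolding Complex_eq by measurable
  show "emeasure ?D (box l u) = (\<Prod>b\<in>Basis. (u - l) \<bullet> b)"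
    if "\<And>b. b \<in> Basis \<Longrightarrow> l \<bullet> b \<le> u \<bullet> b" for l u :: complex
  proof -
    have le: "Re l \<le> Re u" "Im l \<le> Im u"
      using that [of 1] that [of \<i>] by (auto simp: Basis_complex_def)
    have "(\<lambda>(x, y). Complex x y) -` box l u = {Re l<..<Re u} \<times> {Im l<..<Im u}"
      by (auto simp: in_box_complex_iff)
    then have "emeasure ?D (box l u)
        = emeasure (lborel \<Otimes>\<^sub>M lborel) ({Re l<..<Re u} \<times> {Im l<..<Im u} :: (real \<times> real) set)"
      by (subst emeasure_distr) (auto simp: space_pair_measure)
    also have "\<dots> = emeasure lborel {Re l<..<Re u} * emeasure lborel {Im l<..<Im u}"
      by (simp add: lborel.emeasure_pair_measure_Times)
    also have "\<dots> = (\<Prod>b\<in>Basis. (u - l) \<bullet> b)"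
      using le by (simp add: Basis_complex_def ennreal_mult)
    finally show ?thesis .
  qed
qed simp

lemma integral_complex_iterated:
  fixes f :: "complex \<Rightarrow> complex"
  assumes "integrable lborel f"
  shows "integral\<^sup>L lborel f = (\<integral>y. (\<integral>x. f (Complex x y) \<partial>lborel) \<partial>lborel)"
proof -
  have [measurable]: "(\<lambda>(x, y). Complex x y) \<in> borel_measurable (lborel \<Otimes>\<^sub>M lborel)"
    unfolding Complex_eq by measurable
  have [measurable]: "f \<in> borel_measurable borel" using assms by simp
  have "integrable (distr (lborel \<Otimes>\<^sub>M lborel) borel (\<lambda>(x, y). Complex x y)) f"
    using assms by (simp flip: lborel_complex)
  then have "integrable (lborel \<Otimes>\<^sub>M lborel) (\<lambda>(x, y). f (Complex x y))"
    by (subst (asm) integrable_distr_eq) (auto simp: case_prod_unfold)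
  moreover have "integral\<^sup>L lborel f = (\<integral>p. (\<lambda>(x, y). f (Complex x y)) p \<partial>(lborel \<Otimes>\<^sub>M lborel))"
    by (subst lborel_complex, subst integral_distr) (auto simp: case_prod_unfold)
  ultimately show ?thesis
    by (simp add: lborel_pair.integral_snd)
qed

lemma nn_integral_complex_iterated:
  fixes f :: "complex \<Rightarrow> ennreal"
  assumes [measurable]: "f \<in> borel_measurable borel"
  shows "integral\<^sup>N lborel f = (\<integral>\<^sup>+y. (\<integral>\<^sup>+x. f (Complex x y) \<partial>lborel) \<partial>lborel)"
proof -
  have [measurable]: "(\<lambda>(x, y). Complex x y) \<in> borel_measurable (lborel \<Otimes>\<^sub>M lborel)"
    unfolding Complex_eq by measurable
  have "integral\<^sup>N lborel f = (\<integral>\<^sup>+p. (\<lambda>(x, y). f (Complex x y)) p \<partial>(lborel \<Otimes>\<^sub>M lborel))"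
    by (subst lborel_complex, subst nn_integral_distr) (auto simp: case_prod_unfold)
  also have "\<dots> = (\<integral>\<^sup>+y. (\<integral>\<^sup>+x. f (Complex x y) \<partial>lborel) \<partial>lborel)"
    by (subst lborel_pair.nn_integral_snd [symmetric]) (auto simp: case_prod_unfold)
  finally show ?thesis .
qed

lemma nn_integral_inverse_sqrt:
  assumes "K \<ge> 0"
  shows "(\<integral>\<^sup>+x. ennreal (indicator {- K..K} x / sqrt \<bar>x\<bar>) \<partial>lborel) < \<infinity>"
proof -
  let ?k = "\<lambda>x::real. indicator {0..K} x * x powr (- 1 / 2)"
  have "((\<lambda>x. x powr (- 1 / 2)) has_integral (K powr (- 1 / 2 + 1) / (- 1 / 2 + 1))) {0..K}"
    using assms by (intro has_integral_powr_from_0) auto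
  then have "(?k has_integral (K powr (- 1 / 2 + 1) / (- 1 / 2 + 1))) UNIV"
    by (subst (asm) has_integral_restrict_UNIV [symmetric]) (simp add: indicator_def if_distrib [of "\<lambda>t. t * _"] of_bool_def cong: if_cong)
  then have k: "(\<integral>\<^sup>+x. ennreal (?k x) \<partial>lborel) = ennreal (K powr (- 1 / 2 + 1) / (- 1 / 2 + 1))"
    by (intro nn_integral_has_integral_lborel) auto
  have "(\<integral>\<^sup>+x. ennreal (?k x) \<partial>lborel) = (\<integral>\<^sup>+x. ennreal (?k x) \<partial>(distr lborel borel uminus))"
    by (simp add: lborel_distr_uminus)
  also have "\<dots> = (\<integral>\<^sup>+x. ennreal (?k (- x)) \<partial>lborel)"
    by (subst nn_integral_distr) auto
  finally have k': "(\<integral>\<^sup>+x. ennreal (?k (- x)) \<partial>lborel) = (\<integral>\<^sup>+x. ennreal (?k x) \<partial>lborel)" ..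
  have "(\<integral>\<^sup>+x. ennreal (indicator {- K..K} x / sqrt \<bar>x\<bar>) \<partial>lborel)
      \<le> (\<integral>\<^sup>+x. (ennreal (?k x) + ennreal (?k (- x))) \<partial>lborel)"
  proof (intro nn_integral_mono)
    fix x :: real
    have "indicator {- K..K} x / sqrt \<bar>x\<bar> \<le> ?k x + ?k (- x)"
      by (cases "x \<ge> 0") (auto simp: indicator_def powr_minus powr_half_sqrt divide_simps)
    then show "ennreal (indicator {- K..K} x / sqrt \<bar>x\<bar>) \<le> ennreal (?k x) + ennreal (?k (- x))"
      by (subst ennreal_plus [symmetric]) (auto intro: ennreal_leI simp del: ennreal_plus)
  qed
  also have "\<dots> = (\<integral>\<^sup>+x. ennreal (?k x) \<partial>lborel) + (\<integral>\<^sup>+x. ennreal (?k (- x)) \<partial>lborel)"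
    by (intro nn_integral_add) auto
  also have "\<dots> < \<infinity>"
    unfolding k' k by simp
  finally show ?thesis .
qed

text \<open>The singularity of the Cauchy kernel is integrable in the plane. By the arithmetic--geometric mean
inequality $|x||y| \le |w|^2$, so the kernel is dominated by the product
$|x|^{-1/2}|y|^{-1/2}$, which reduces the claim to one dimension.\<close>

lemma nn_integral_inverse_norm_square:
  assumes "K \<ge> 0"
  shows "(\<integral>\<^sup>+w. ennreal (indicator (cbox (Complex (- K) (- K)) (Complex K K)) w / norm w) \<partial>lborel) < \<infinity>"
proof -
  let ?Q = "cbox (Complex (- K) (- K)) (Complex K K)"
  let ?h = "\<lambda>x. ennreal (indicator {- K..K} x / sqrt \<bar>x\<bar>)"
  have "(\<integral>\<^sup>+w. ennreal (indicator ?Q w / norm w) \<partial>lborel)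
      = (\<integral>\<^sup>+y. (\<integral>\<^sup>+x. ennreal (indicator ?Q (Complex x y) / norm (Complex x y)) \<partial>lborel) \<partial>lborel)"
    by (subst nn_integral_complex_iterated) auto
  also have "\<dots> \<le> (\<integral>\<^sup>+y. (\<integral>\<^sup>+x. ?h x * ?h y \<partial>lborel) \<partial>lborel)"
  proof (rule nn_integral_mono_AE)
    have bound: "ennreal (indicator ?Q (Complex x y) / norm (Complex x y)) \<le> ?h x * ?h y"
      if xy: "x \<noteq> 0" "y \<noteq> 0" for x y
    proof -
      have "\<bar>x\<bar> * \<bar>y\<bar> \<le> x\<^sup>2 + y\<^sup>2"
        using sum_squares_bound [of "\<bar>x\<bar>" "\<bar>y\<bar>"] mult_nonneg_nonneg [of "\<bar>x\<bar>" "\<bar>y\<bar>"]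
        unfolding power2_abs by linarith
      then have "sqrt \<bar>x\<bar> * sqrt \<bar>y\<bar> \<le> norm (Complex x y)"
        by (simp add: complex_norm real_sqrt_mult [symmetric])
      moreover have "0 < sqrt \<bar>x\<bar> * sqrt \<bar>y\<bar>" using xy by simp
      ultimately have "1 / norm (Complex x y) \<le> 1 / (sqrt \<bar>x\<bar> * sqrt \<bar>y\<bar>)"
        by (intro frac_le) auto
      then show ?thesis
        by (subst ennreal_mult [symmetric])
          (auto simp: indicator_def in_cbox_complex_iff intro!: ennreal_leI)
    qed
    have nz: "AE x in lborel. x \<noteq> (0::real)" by (rule AE_lborel_singleton)
    show "AE y in lborel. (\<integral>\<^sup>+x. ennreal (indicator ?Q (Complex x y) / norm (Complex x y)) \<partial>lborel)
        \<le> (\<integral>\<^sup>+x. ?h x * ?h y \<partial>lborel)"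
      using nz
    proof eventually_elim
      case (elim y)
      show ?case
        by (rule nn_integral_mono_AE, use nz in eventually_elim) (use elim bound in auto)
    qed
  qed
  also have "\<dots> = (\<integral>\<^sup>+x. ?h x \<partial>lborel) * (\<integral>\<^sup>+y. ?h y \<partial>lborel)"
    by (simp add: nn_integral_multc nn_integral_cmult)
  also have "\<dots> < \<infinity>"
    using nn_integral_inverse_sqrt [OF assms] by (simp add: ennreal_mult_less_top)
  finally show ?thesis .
qed

abbreviation csquare :: "real \<Rightarrow> complex set"
  where "csquare M \<equiv> cbox (Complex (- M) (- M)) (Complex M M)"

text \<open>Translating by \<open>\<zeta>\<close> moves the square into one of twice the size, which gives a bound that does not
depend on \<open>\<zeta>\<close>. The uniformity is what Fubini's theorem for a whole curve of points needs.\<close>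

lemma nn_integral_cauchy_kernel_le:
  assumes "\<zeta> \<in> csquare M"
  shows "(\<integral>\<^sup>+w. ennreal (indicator (csquare M) w / norm (\<zeta> - w)) \<partial>lborel)
    \<le> (\<integral>\<^sup>+w. ennreal (indicator (csquare (2 * M)) w / norm w) \<partial>lborel)"
proof -
  have "(\<integral>\<^sup>+w. ennreal (indicator (csquare M) w / norm (\<zeta> - w)) \<partial>lborel)
      \<le> (\<integral>\<^sup>+w. ennreal (indicator (csquare (2 * M)) (- \<zeta> + w) / norm (- \<zeta> + w)) \<partial>lborel)"
    using assms
    by (intro nn_integral_mono ennreal_leI)
      (auto simp: indicator_def in_cbox_complex_iff norm_minus_commute)
  also have "\<dots> = (\<integral>\<^sup>+w. ennreal (indicator (csquare (2 * M)) w / norm w) \<partial>distr lborel borel ((+) (- \<zeta>)))"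
    by (subst nn_integral_distr) auto
  finally show ?thesis by (simp only: lborel_distr_plus)
qed

lemma integrable_cauchy_kernel:
  assumes "\<zeta> \<in> csquare M"
  shows "integrable lborel (\<lambda>w. indicator (csquare M) w *\<^sub>R (1 / (\<zeta> - w)))"
proof (rule integrableI_bounded)
  have "M \<ge> 0" using assms by (auto simp: in_cbox_complex_iff)
  have "(\<integral>\<^sup>+w. ennreal (norm (indicator (csquare M) w *\<^sub>R (1 / (\<zeta> - w)))) \<partial>lborel)
      = (\<integral>\<^sup>+w. ennreal (indicator (csquare M) w / norm (\<zeta> - w)) \<partial>lborel)"
    by (simp add: norm_divide)
  also have "\<dots> < \<infinity>"
    using nn_integral_cauchy_kernel_le [OF assms] nn_integral_inverse_norm_square [of "2 * M"] \<open>M \<ge> 0\<close>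
    by (auto intro: le_less_trans)
  finally show "(\<integral>\<^sup>+w. ennreal (norm (indicator (csquare M) w *\<^sub>R (1 / (\<zeta> - w)))) \<partial>lborel) < \<infinity>" .
qed simp

text \<open>The holomorphic part of the integral of $1/(\zeta - w)$ along the horizontal segment at height
\<open>y\<close>. Both logarithms have arguments in the right half-plane as long as \<open>\<bar>Re \<zeta>\<bar> < M\<close>.\<close>

definition kernel_potential :: "real \<Rightarrow> real \<Rightarrow> complex \<Rightarrow> complex"
  where "kernel_potential M y \<zeta> = Ln (\<zeta> + of_real M - \<i> * of_real y) - Ln (of_real M + \<i> * of_real y - \<zeta>)"

lemma continuous_on_kernel_potential [continuous_intros]:
  assumes "continuous_on A f" "continuous_on A g" "\<And>x. x \<in> A \<Longrightarrow> \<bar>Re (g x)\<bar> < M"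
  shows "continuous_on A (\<lambda>x. kernel_potential M (f x) (g x))"
  unfolding kernel_potential_def
proof (intro continuous_intros assms)
  fix x assume "x \<in> A"
  from assms(3) [OF this]
  show "g x + of_real M - \<i> * of_real (f x) \<notin> \<real>\<^sub>\<le>\<^sub>0" "of_real M + \<i> * of_real (f x) - g x \<notin> \<real>\<^sub>\<le>\<^sub>0"
    by (auto simp: complex_nonpos_Reals_iff)
qed

text \<open>A primitive is $-\mathrm{Ln}(\zeta - w)$. At the right end of the segment the argument lies in the left
half-plane, above or below the branch cut according to the sign of \<open>Im \<zeta> - y\<close>; reflecting it into the
right half-plane isolates this sign, the only part that is not holomorphic in \<open>\<zeta>\<close>.\<close>

lemma integral_cauchy_kernel_line:
  assumes \<zeta>: "\<bar>Re \<zeta>\<bar> < M" and y: "y \<noteq> Im \<zeta>"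
  shows "(\<integral>x. indicator {- M..M} x *\<^sub>R (1 / (\<zeta> - Complex x y)) \<partial>lborel)
    = kernel_potential M y \<zeta> - \<i> * of_real pi * of_real (sgn (Im \<zeta> - y))"
proof -
  let ?F = "\<lambda>x. - Ln (\<zeta> - Complex x y)"
  have nonpos: "\<zeta> - Complex x y \<notin> \<real>\<^sub>\<le>\<^sub>0" and nz: "\<zeta> - Complex x y \<noteq> 0" for x
    using y by (auto simp: complex_nonpos_Reals_iff complex_eq_iff)
  have deriv: "(?F has_vector_derivative 1 / (\<zeta> - Complex x y)) (at x within A)" for x A
  proof -
    have "((\<lambda>x. \<zeta> - \<i> * of_real y - of_real x) has_vector_derivative - 1) (at x within A)"
      by (auto intro!: derivative_eq_intros)
    then have 1: "((\<lambda>x. \<zeta> - Complex x y) has_vector_derivative - 1) (at x within A)"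
      by (simp add: Complex_eq algebra_simps)
    have "((\<lambda>u. - Ln u) has_field_derivative - (1 / (\<zeta> - Complex x y))) (at (\<zeta> - Complex x y))"
      using nonpos by (auto intro!: derivative_eq_intros simp: inverse_eq_divide)
    from field_vector_diff_chain_within [OF 1 DERIV_subset [OF this]]
    show ?thesis by (simp add: o_def)
  qed
  have "(\<integral>x. indicator {- M..M} x *\<^sub>R (1 / (\<zeta> - Complex x y)) \<partial>lborel) = ?F M - ?F (- M)"
    using \<zeta> nz by (intro integral_FTC_atLeastAtMost deriv) (auto intro!: continuous_intros simp: Complex_eq)
  also have "\<dots> = Ln (\<zeta> + of_real M - \<i> * of_real y) - Ln (- (of_real M + \<i> * of_real y - \<zeta>))"
    by (simp add: Complex_eq algebra_simps)
  also have "Ln (- (of_real M + \<i> * of_real y - \<zeta>))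
      = Ln (of_real M + \<i> * of_real y - \<zeta>) + \<i> * of_real pi * of_real (sgn (Im \<zeta> - y))"
    using \<zeta> y by (subst Ln_minus) (auto simp: complex_eq_iff sgn_if)
  finally show ?thesis by (simp add: kernel_potential_def)
qed

text \<open>Up to a function holomorphic in \<open>\<zeta>\<close>, the Cauchy transform of the square is
$-2\pi \mathrm{i}\, \mathrm{Im}\,\zeta$: the signs of \<open>Im \<zeta> - y\<close> integrate to \<open>2 Im \<zeta>\<close>.\<close>

lemma integral_cauchy_kernel_square:
  assumes \<zeta>: "\<bar>Re \<zeta>\<bar> < M" "\<bar>Im \<zeta>\<bar> < M"
  shows "(\<integral>w. indicator (csquare M) w *\<^sub>R (1 / (\<zeta> - w)) \<partial>lborel)
    = integral {- M..M} (\<lambda>y. kernel_potential M y \<zeta>) - 2 * of_real pi * \<i> * of_real (Im \<zeta>)"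
proof -
  let ?f = "\<lambda>w. indicator (csquare M) w *\<^sub>R (1 / (\<zeta> - w))"
  let ?h = "\<lambda>y. kernel_potential M y \<zeta> - \<i> * of_real pi * of_real (sgn (Im \<zeta> - y))"
  have M: "M > 0" using \<zeta> by linarith
  have Q: "\<zeta> \<in> csquare M" using \<zeta> by (auto simp: in_cbox_complex_iff)
  have cont: "continuous_on {- M..M} (\<lambda>y. kernel_potential M y \<zeta>)"
    using \<zeta> by (intro continuous_intros) auto
  have sgn: "((\<lambda>y. sgn (Im \<zeta> - y)) has_integral 2 * Im \<zeta>) {- M..M}"
  proof -
    have "((\<lambda>y. sgn (Im \<zeta> - y)) has_integral (- \<bar>Im \<zeta> - M\<bar>) - (- \<bar>Im \<zeta> - (- M)\<bar>)) {- M..M}"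
    \<comment> \<open>\<open>-\<bar>Im \<zeta> - y\<bar>\<close> is a primitive of the sign, except at \<open>y = Im \<zeta>\<close>.\<close>
    proof (rule fundamental_theorem_of_calculus_strong [of "{Im \<zeta>}"])
      fix y assume "y \<in> {- M..M} - {Im \<zeta>}"
      then consider "y < Im \<zeta>" | "Im \<zeta> < y" by fastforce
      then have "((\<lambda>y. - \<bar>Im \<zeta> - y\<bar>) has_real_derivative sgn (Im \<zeta> - y)) (at y)"
      proof cases
        case 1
        have "((\<lambda>y. y - Im \<zeta>) has_real_derivative sgn (Im \<zeta> - y)) (at y)"
          using 1 by (auto intro!: derivative_eq_intros)
        then show ?thesis
          by (rule has_field_derivative_transform_within_open [where S = "{..<Im \<zeta>}"]) (use 1 in auto)
      next
        case 2
        have "((\<lambda>y. Im \<zeta> - y) has_real_derivative sgn (Im \<zeta> - y)) (at y)"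
          using 2 by (auto intro!: derivative_eq_intros)
        then show ?thesis
          by (rule has_field_derivative_transform_within_open [where S = "{Im \<zeta><..}"]) (use 2 in auto)
      qed
      then show "((\<lambda>y. - \<bar>Im \<zeta> - y\<bar>) has_vector_derivative sgn (Im \<zeta> - y)) (at y)"
        by (simp add: has_real_derivative_iff_has_vector_derivative)
    qed (use M in \<open>auto intro!: continuous_intros\<close>)
    then show ?thesis using \<zeta> by (simp add: abs_if split: if_splits)
  qed
  have sgn_int: "set_integrable lborel {- M..M} (\<lambda>y. complex_of_real (sgn (Im \<zeta> - y)))"
    unfolding set_integrable_def
    by (rule integrableI_bounded_set_indicator [where B = 1]) (auto simp: sgn_if emeasure_lborel_Icc_eq)
  have h_int: "set_integrable lborel {- M..M} ?h"
    using borel_integrable_atLeastAtMost' [OF cont] sgn_int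
    by (intro set_integral_diff set_integrable_mult_right) auto
  have "integral\<^sup>L lborel ?f = (\<integral>y. (\<integral>x. ?f (Complex x y) \<partial>lborel) \<partial>lborel)"
    by (rule integral_complex_iterated [OF integrable_cauchy_kernel [OF Q]])
  also have "\<dots> = (\<integral>y. indicator {- M..M} y *\<^sub>R (\<integral>x. indicator {- M..M} x *\<^sub>R (1 / (\<zeta> - Complex x y)) \<partial>lborel) \<partial>lborel)"
  proof (intro Bochner_Integration.integral_cong refl)
    fix y :: real
    have "?f (Complex x y) = indicator {- M..M} y *\<^sub>R (indicator {- M..M} x *\<^sub>R (1 / (\<zeta> - Complex x y)))" for x
      by (auto simp: indicator_def in_cbox_complex_iff)
    then show "(\<integral>x. ?f (Complex x y) \<partial>lborel)
        = indicator {- M..M} y *\<^sub>R (\<integral>x. indicator {- M..M} x *\<^sub>R (1 / (\<zeta> - Complex x y)) \<partial>lborel)"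
      by (simp only: integral_scaleR_right)
  qed
  also have "\<dots> = (\<integral>y. indicator {- M..M} y *\<^sub>R ?h y \<partial>lborel)"
  proof (rule integral_cong_AE)
    show "AE y in lborel. indicator {- M..M} y *\<^sub>R (\<integral>x. indicator {- M..M} x *\<^sub>R (1 / (\<zeta> - Complex x y)) \<partial>lborel)
        = indicator {- M..M} y *\<^sub>R ?h y"
      using AE_lborel_singleton [of "Im \<zeta>"]
      by eventually_elim (simp add: integral_cauchy_kernel_line [OF \<zeta>(1)])
    show "(\<lambda>y. indicator {- M..M} y *\<^sub>R ?h y) \<in> borel_measurable lborel"
      using h_int unfolding set_integrable_def by (rule borel_measurable_integrable)
    have "(\<lambda>(y, x). indicator {- M..M} x *\<^sub>R (1 / (\<zeta> - Complex x y))) \<in> borel_measurable (lborel \<Otimes>\<^sub>M lborel)"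
      unfolding Complex_eq by measurable
    from lborel.borel_measurable_lebesgue_integral [OF this]
    show "(\<lambda>y. indicator {- M..M} y *\<^sub>R (\<integral>x. indicator {- M..M} x *\<^sub>R (1 / (\<zeta> - Complex x y)) \<partial>lborel))
        \<in> borel_measurable lborel"
      by measurable
  qed
  also have "\<dots> = integral {- M..M} ?h"
    using set_borel_integral_eq_integral(2) [OF h_int] by (simp add: set_lebesgue_integral_def)
  also have "\<dots> = integral {- M..M} (\<lambda>y. kernel_potential M y \<zeta>) - 2 * of_real pi * \<i> * of_real (Im \<zeta>)"
  proof (rule integral_unique)
    have "((\<lambda>y. \<i> * of_real pi * of_real (sgn (Im \<zeta> - y))) has_integral \<i> * of_real pi * of_real (2 * Im \<zeta>)) {- M..M}"
      by (intro has_integral_mult_right has_integral_of_real sgn)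
    then have "(?h has_integral integral {- M..M} (\<lambda>y. kernel_potential M y \<zeta>) - \<i> * of_real pi * of_real (2 * Im \<zeta>)) {- M..M}"
      using cont by (intro has_integral_diff integrable_integral integrable_continuous_interval)
    then show "(?h has_integral integral {- M..M} (\<lambda>y. kernel_potential M y \<zeta>) - 2 * of_real pi * \<i> * of_real (Im \<zeta>)) {- M..M}"
      by (simp add: mult_ac)
  qed
  finally show ?thesis .
qed

text \<open>Cauchy's theorem for the potential, with the explicit primitive coming from $u \,\mathrm{Ln}\, u - u$.\<close>

lemma integral_kernel_potential_loop:
  assumes L: "L \<ge> 0" and closed: "z L = z 0"
    and deriv: "\<And>s. s \<in> {0..L} \<Longrightarrow> (z has_vector_derivative z' s) (at s within {0..L})"
    and M: "\<And>s. s \<in> {0..L} \<Longrightarrow> \<bar>Re (z s)\<bar> < M"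
  shows "((\<lambda>s. z' s * kernel_potential M y (z s)) has_integral 0) {0..L}"
proof -
  let ?A = "\<lambda>\<zeta>. \<zeta> + of_real M - \<i> * of_real y" and ?V = "\<lambda>\<zeta>. of_real M + \<i> * of_real y - \<zeta>"
  define H where "H \<zeta> = ?A \<zeta> * Ln (?A \<zeta>) + ?V \<zeta> * Ln (?V \<zeta>)" for \<zeta>
  have "(H has_field_derivative kernel_potential M y \<zeta>) (at \<zeta>)" if "\<bar>Re \<zeta>\<bar> < M" for \<zeta>
  proof -
    have n: "?A \<zeta> \<notin> \<real>\<^sub>\<le>\<^sub>0" "?V \<zeta> \<notin> \<real>\<^sub>\<le>\<^sub>0"
      using that by (auto simp: complex_nonpos_Reals_iff)
    then have nz: "?A \<zeta> \<noteq> 0" "?V \<zeta> \<noteq> 0" by auto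
    show ?thesis
      unfolding H_def kernel_potential_def
      by (rule derivative_eq_intros refl n | simp add: nz left_inverse [OF nz(1)] left_inverse [OF nz(2)])+
  qed
  then have "((\<lambda>s. H (z s)) has_vector_derivative z' s * kernel_potential M y (z s)) (at s within {0..L})"
    if "s \<in> {0..L}" for s
    using field_vector_diff_chain_within [OF deriv [OF that], of H "kernel_potential M y (z s)"] M [OF that]
    by (simp add: o_def has_field_derivative_at_within)
  then have "((\<lambda>s. z' s * kernel_potential M y (z s)) has_integral H (z L) - H (z 0)) {0..L}"
    by (rule fundamental_theorem_of_calculus [OF L])
  then show ?thesis by (simp add: closed)
qed

section \<open>Area from winding numbers\<close>

lemma integrable_cauchy_kernel_curve:
  fixes z z' :: "real \<Rightarrow> complex"
  assumes L: "L \<ge> 0" and cz: "continuous_on UNIV z" and cz': "continuous_on UNIV z'"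
    and M: "\<And>s. s \<in> {0..L} \<Longrightarrow> z s \<in> csquare M"
  shows "integrable (lborel \<Otimes>\<^sub>M lborel)
    (\<lambda>(s, w). indicator {0..L} s *\<^sub>R indicator (csquare M) w *\<^sub>R (z' s / (z s - w)))"
    (is "integrable _ (\<lambda>(s, w). ?f s w)")
proof (rule integrableI_bounded)
  have [measurable]: "z \<in> borel_measurable borel" "z' \<in> borel_measurable borel"
    using cz cz' by (auto intro: borel_measurable_continuous_onI)
  show meas: "(\<lambda>(s, w). ?f s w) \<in> borel_measurable (lborel \<Otimes>\<^sub>M lborel)"
    unfolding case_prod_unfold
    by (intro borel_measurable_scaleR borel_measurable_divide borel_measurable_diff
        measurable_compose [OF measurable_fst] measurable_compose [OF measurable_snd])
      (auto intro!: borel_measurable_indicator)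
  have M0: "M \<ge> 0" using M [of 0] L by (auto simp: in_cbox_complex_iff)
  define C where "C = (\<integral>\<^sup>+w. ennreal (indicator (csquare (2 * M)) w / norm w) \<partial>lborel)"
  have C: "C < \<infinity>"
    unfolding C_def using M0 by (intro nn_integral_inverse_norm_square) auto
  have "compact (z' ` {0..L})"
    using cz' by (intro compact_continuous_image) (auto intro: continuous_on_subset)
  then obtain B where B: "\<And>s. s \<in> {0..L} \<Longrightarrow> norm (z' s) \<le> B" "B \<ge> 0"
    using compact_imp_bounded bounded_pos less_imp_le by (metis imageI)
  have inner: "(\<integral>\<^sup>+w. ennreal (norm (?f s w)) \<partial>lborel) \<le> indicator {0..L} s * (ennreal B * C)" for s
  proof (cases "s \<in> {0..L}")
    case True
    have "(\<integral>\<^sup>+w. ennreal (norm (?f s w)) \<partial>lborel)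
        = (\<integral>\<^sup>+w. ennreal (norm (z' s)) * ennreal (indicator (csquare M) w / norm (z s - w)) \<partial>lborel)"
      using True by (intro nn_integral_cong) (simp add: norm_divide ennreal_mult' [symmetric])
    also have "\<dots> = ennreal (norm (z' s)) * (\<integral>\<^sup>+w. ennreal (indicator (csquare M) w / norm (z s - w)) \<partial>lborel)"
      by (rule nn_integral_cmult) simp
    also have "\<dots> \<le> ennreal B * C"
      unfolding C_def using True B(1) M by (intro mult_mono ennreal_leI nn_integral_cauchy_kernel_le) auto
    finally show ?thesis using True by simp
  qed simp
  have "(\<integral>\<^sup>+p. ennreal (norm (case p of (s, w) \<Rightarrow> ?f s w)) \<partial>(lborel \<Otimes>\<^sub>M lborel))
      = (\<integral>\<^sup>+s. (\<integral>\<^sup>+w. ennreal (norm (?f s w)) \<partial>lborel) \<partial>lborel)"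
    by (subst lborel.nn_integral_fst [symmetric]) (use meas in auto)
  also have "\<dots> \<le> (\<integral>\<^sup>+s. indicator {0..L} s * (ennreal B * C) \<partial>lborel)"
    by (intro nn_integral_mono inner)
  also have "\<dots> = ennreal L * (ennreal B * C)"
    using L by (subst nn_integral_multc) auto
  also have "\<dots> < \<infinity>"
    using C by (simp add: ennreal_mult_less_top)
  finally show "(\<integral>\<^sup>+p. ennreal (norm (case p of (s, w) \<Rightarrow> ?f s w)) \<partial>(lborel \<Otimes>\<^sub>M lborel)) < \<infinity>" .
qed

lemma negligible_C1_curve:
  fixes z :: "real \<Rightarrow> complex"
  assumes "\<And>s. (z has_vector_derivative z' s) (at s)"
  shows "negligible (z ` A)"
proof -
  have "z differentiable_on A"
    using assms differentiableI_vector differentiable_at_imp_differentiable_on by blast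
  then show ?thesis
    by (intro negligible_differentiable_image_lowdim) auto
qed

text \<open>The double integral of $z'(s)/(z(s) - w)$ over the period and over a large square is
computed in both orders. Over the curve first, it is $2\pi \mathrm{i}$ times the winding number, whose
integral is the area. Over the square first, it is the Cauchy transform of the square along the curve:
its holomorphic part contributes nothing because the curve is closed, and the rest is
$-2\pi \mathrm{i} \int y\, dz$.\<close>

theorem area_by_winding_integral:
  fixes z z' :: "real \<Rightarrow> complex"
  assumes L: "L \<ge> 0" and closed: "z L = z 0"
    and deriv: "\<And>s. (z has_vector_derivative z' s) (at s)"
    and cz': "continuous_on UNIV z'"
    and \<Omega>: "\<Omega> \<in> lmeasurable" "bounded \<Omega>"
    and winding: "\<And>w. w \<notin> z ` {0..L} \<Longrightarrow>
      integral {0..L} (\<lambda>s. z' s / (z s - w)) = 2 * of_real pi * \<i> * indicator \<Omega> w"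
  shows "measure lebesgue \<Omega> = - integral {0..L} (\<lambda>s. Im (z s) * Re (z' s))"
proof -
  have cz: "continuous_on UNIV z"
    using deriv by (auto intro!: continuous_on_vector_derivative intro: has_vector_derivative_at_within)
  have [measurable]: "z \<in> borel_measurable borel" "z' \<in> borel_measurable borel"
    using cz cz' by (auto intro: borel_measurable_continuous_onI)
  have czL: "continuous_on {0..L} z" and czL': "continuous_on {0..L} z'"
    using cz cz' by (auto intro: continuous_on_subset)
  have "bounded (\<Omega> \<union> z ` {0..L})"
    using \<Omega>(2) compact_imp_bounded [OF compact_continuous_image [OF czL]] by simp
  then obtain M where M: "M > 0" "\<And>w. w \<in> \<Omega> \<union> z ` {0..L} \<Longrightarrow> norm w < M"
    unfolding bounded_pos_less by blast
  have M': "\<bar>Re w\<bar> < M" "\<bar>Im w\<bar> < M" if "w \<in> \<Omega> \<union> z ` {0..L}" for w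
    using M(2) [OF that] abs_Re_le_cmod [of w] abs_Im_le_cmod [of w] by linarith+
  have sub: "w \<in> csquare M" if "w \<in> \<Omega> \<union> z ` {0..L}" for w
    using M' [OF that] by (auto simp: in_cbox_complex_iff)
  let ?f = "\<lambda>s w. indicator {0..L} s *\<^sub>R indicator (csquare M) w *\<^sub>R (z' s / (z s - w))"
  have int: "integrable (lborel \<Otimes>\<^sub>M lborel) (\<lambda>(s, w). ?f s w)"
    using sub by (intro integrable_cauchy_kernel_curve L cz cz') auto
  have Fubini: "(\<integral>w. (\<integral>s. ?f s w \<partial>lborel) \<partial>lborel) = (\<integral>s. (\<integral>w. ?f s w \<partial>lborel) \<partial>lborel)"
    by (rule lborel_pair.Fubini_integral [OF int])

  have "(\<integral>w. (\<integral>s. ?f s w \<partial>lborel) \<partial>lborel) = (\<integral>w. (\<integral>s. ?f s w \<partial>lborel) \<partial>lebesgue)"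
    by (rule integral_completion [symmetric])
      (use lborel_pair.integrable_snd [OF int] borel_measurable_integrable in auto)
  also have "\<dots> = (\<integral>w. indicator \<Omega> w *\<^sub>R (2 * of_real pi * \<i>) \<partial>lebesgue)"
  proof (rule integral_cong_AE)
    \<comment> \<open>On the curve itself the winding number is meaningless, but the curve is a null set.\<close>
    have "AE w in lebesgue. w \<notin> z ` {0..L}"
      using negligible_C1_curve [OF deriv] by (intro AE_not_in) (simp add: negligible_iff_null_sets)
    then show "AE w in lebesgue. (\<integral>s. ?f s w \<partial>lborel) = indicator \<Omega> w *\<^sub>R (2 * of_real pi * \<i>)"
    proof eventually_elim
      case (elim w)
      have "continuous_on {0..L} (\<lambda>s. z' s / (z s - w))"
        using elim by (intro continuous_intros czL czL') auto
      then have "(\<integral>s. indicator {0..L} s *\<^sub>R (z' s / (z s - w)) \<partial>lborel) = 2 * of_real pi * \<i> * indicator \<Omega> w"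
        using winding [OF elim]
        by (simp add: set_borel_integral_eq_integral(2) borel_integrable_atLeastAtMost' flip: set_lebesgue_integral_def)
      moreover have "(\<integral>s. ?f s w \<partial>lborel)
          = indicator (csquare M) w *\<^sub>R (\<integral>s. indicator {0..L} s *\<^sub>R (z' s / (z s - w)) \<partial>lborel)"
        by (subst integral_scaleR_right [symmetric]) (simp add: mult.commute)
      ultimately show ?case
        using sub [of w] by (auto simp: indicator_def)
    qed
    show "(\<lambda>w. \<integral>s. ?f s w \<partial>lborel) \<in> borel_measurable lebesgue"
      using lborel_pair.integrable_snd [OF int] borel_measurable_integrable measurable_completion by blast
    show "(\<lambda>w. indicator \<Omega> w *\<^sub>R (2 * of_real pi * \<i> :: complex)) \<in> borel_measurable lebesgue"
      using \<Omega>(1) by (intro borel_measurable_scaleR borel_measurable_indicator) (auto simp: fmeasurable_def)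
  qed
  also have "\<dots> = 2 * of_real pi * \<i> * of_real (measure lebesgue \<Omega>)"
    using \<Omega>(1) by (subst integral_scaleR_left) (auto simp: scaleR_conv_of_real fmeasurable_def)
  finally have left: "(\<integral>w. (\<integral>s. ?f s w \<partial>lborel) \<partial>lborel) = 2 * of_real pi * \<i> * of_real (measure lebesgue \<Omega>)" .

  let ?P = "\<lambda>s. integral {- M..M} (\<lambda>y. kernel_potential M y (z s))"
  let ?g = "\<lambda>s. z' s * (?P s - 2 * of_real pi * \<i> * of_real (Im (z s)))"
  have inner: "(\<integral>w. ?f s w \<partial>lborel) = indicator {0..L} s *\<^sub>R ?g s" for s
  proof (cases "s \<in> {0..L}")
    case True
    have "(\<integral>w. ?f s w \<partial>lborel) = (\<integral>w. z' s * (indicator (csquare M) w *\<^sub>R (1 / (z s - w))) \<partial>lborel)"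
      using True by (intro Bochner_Integration.integral_cong) auto
    also have "\<dots> = ?g s"
      using True M' by (subst integral_mult_right_zero, subst integral_cauchy_kernel_square) auto
    finally show ?thesis using True by simp
  qed simp
  have "set_integrable lborel {0..L} ?g"
    using lborel_pair.integrable_fst [OF int] unfolding inner set_integrable_def .
  note g = set_borel_integral_eq_integral [OF this]
  have y_int: "(\<lambda>s. z' s * of_real (Im (z s))) integrable_on {0..L}"
    by (intro integrable_continuous_interval continuous_intros czL czL')
  have "((\<lambda>s. ?g s + 2 * of_real pi * \<i> * (z' s * of_real (Im (z s)))) has_integral
      integral {0..L} ?g + 2 * of_real pi * \<i> * integral {0..L} (\<lambda>s. z' s * of_real (Im (z s)))) {0..L}"
    using g(1) y_int by (intro has_integral_add has_integral_mult_right integrable_integral)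
  then have potential: "integral {0..L} (\<lambda>s. z' s * ?P s)
      = integral {0..L} ?g + 2 * of_real pi * \<i> * integral {0..L} (\<lambda>s. z' s * of_real (Im (z s)))"
    by (intro integral_unique) (simp add: algebra_simps)
  have zero: "integral {0..L} (\<lambda>s. z' s * ?P s) = 0"
  proof -
    have swap: "integral (cbox 0 L) (\<lambda>s. integral (cbox (- M) M) (\<lambda>y. z' s * kernel_potential M y (z s)))
        = integral (cbox (- M) M) (\<lambda>y. integral (cbox 0 L) (\<lambda>s. z' s * kernel_potential M y (z s)))"
    proof (rule integral_swap_continuous)
      show "continuous_on (cbox (0, - M) (L, M)) (\<lambda>(s, y). z' s * kernel_potential M y (z s))"
        unfolding case_prod_unfold
        by (intro continuous_intros continuous_on_compose2 [OF cz'] continuous_on_compose2 [OF cz])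
          (auto simp: cbox_Pair_eq intro!: M')
    qed
    have "integral (cbox 0 L) (\<lambda>s. z' s * kernel_potential M y (z s)) = 0" for y
      unfolding cbox_interval
      by (rule integral_unique, rule integral_kernel_potential_loop [OF L closed])
        (simp_all add: has_vector_derivative_at_within [OF deriv] M')
    with swap show ?thesis by simp
  qed
  have "integral {0..L} ?g = 2 * of_real pi * \<i> * of_real (measure lebesgue \<Omega>)"
    using Fubini left g(2) unfolding inner by (simp only: set_lebesgue_integral_def)
  with potential zero
  have "2 * of_real pi * \<i> * (of_real (measure lebesgue \<Omega>) + integral {0..L} (\<lambda>s. z' s * of_real (Im (z s)))) = 0"
    by (simp only: distrib_left)
  then have "complex_of_real (measure lebesgue \<Omega>) = - integral {0..L} (\<lambda>s. z' s * of_real (Im (z s)))"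
    by (simp add: add_eq_0_iff2)
  then have "measure lebesgue \<Omega> = - Re (integral {0..L} (\<lambda>s. z' s * of_real (Im (z s))))"
    by (metis Re_complex_of_real uminus_complex.sel(1))
  also have "Re (integral {0..L} (\<lambda>s. z' s * of_real (Im (z s)))) = integral {0..L} (\<lambda>s. Re (z' s * of_real (Im (z s))))"
    using has_integral_Re [OF integrable_integral [OF y_int]] by (simp add: integral_unique)
  finally show ?thesis by (simp add: mult.commute)
qed

lemma path_image_loop_of: "L > 0 \<Longrightarrow> path_image (loop_of L z) = z ` {0..L}"
proof -
  assume "L > 0"
  then have "(\<lambda>t. L * t) ` {0..1} = {0..L}"
    by (subst image_mult_atLeastAtMost) auto
  then show ?thesis
    unfolding path_image_def loop_of_def by (simp add: image_image flip: image_comp [of z "(*) L", unfolded o_def])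
qed

lemma winding_number_loop_of:
  assumes L: "L > 0"
    and deriv: "\<And>s. (z has_vector_derivative z' s) (at s)"
    and cont: "continuous_on UNIV z'"
    and w: "w \<notin> z ` {0..L}"
  shows "integral {0..L} (\<lambda>s. z' s / (z s - w)) = 2 * of_real pi * \<i> * winding_number (loop_of L z) w"
proof -
  let ?\<gamma> = "loop_of L z"
  let ?f = "\<lambda>s. z' s / (z s - w)"
  have d: "(?\<gamma> has_vector_derivative L *\<^sub>R z' (L * t)) (at t)" for t
  proof -
    have "((\<lambda>t. L * t) has_vector_derivative L) (at t)"
      by (auto intro!: derivative_eq_intros)
    from vector_diff_chain_at [OF this deriv [of "L * t"]] show ?thesis
      by (simp add: o_def loop_of_def)
  qed
  have "continuous_on {0..1} (\<lambda>t. L *\<^sub>R z' (L * t))"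
    by (intro continuous_intros continuous_on_compose2 [OF cont]) auto
  then have "?\<gamma> C1_differentiable_on {0..1}"
    unfolding C1_differentiable_on_def using d by (intro exI [of _ "\<lambda>t. L *\<^sub>R z' (L * t)"]) simp
  then have valid: "valid_path ?\<gamma>"
    unfolding valid_path_def by (rule C1_differentiable_imp_piecewise)
  have "continuous_on UNIV z"
    using deriv has_vector_derivative_continuous by (blast intro: continuous_at_imp_continuous_on)
  then have "continuous_on {0..L} ?f"
    using w by (intro continuous_intros continuous_on_subset [OF cont]) (auto intro: continuous_on_subset)
  then have "(?f has_integral integral {0..L} ?f) {0..L}"
    by (intro integrable_integral integrable_continuous_interval)
  then have "((\<lambda>t. ?f (L * t)) has_integral (1 / L) *\<^sub>R integral {0..L} ?f) {0..1}"
    using has_integral_stretch_real [of ?f _ 0 L L] L by (simp add: image_divide_atLeastAtMost)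
  then have "((\<lambda>t. L *\<^sub>R ?f (L * t)) has_integral L *\<^sub>R (1 / L) *\<^sub>R integral {0..L} ?f) {0..1}"
    by (rule has_integral_cmul)
  then have "integral {0..1} (\<lambda>t. 1 / (?\<gamma> t - w) * vector_derivative ?\<gamma> (at t)) = integral {0..L} ?f"
    unfolding vector_derivative_at [OF d] using L by (intro integral_unique) (simp add: loop_of_def)
  then show ?thesis
    using winding_number_valid_path [OF valid, of w] w path_image_loop_of [OF L, of z]
    by (simp add: contour_integral_integral)
qed

text \<open>\<open>\<Omega>\<close> contains a point of the inside of the curve, because the winding number vanishes outside. The inside
is connected and does not meet the frontier of \<open>\<Omega>\<close>, hence lies in \<open>\<Omega>\<close>.\<close>

lemma winding_number_eq_indicator:
  assumes \<gamma>: "simple_path \<gamma>" "pathfinish \<gamma> = pathstart \<gamma>"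
    and \<Omega>: "open \<Omega>" "frontier \<Omega> = path_image \<gamma>" "counterclockwise \<Omega> \<gamma>"
    and w: "w \<notin> path_image \<gamma>"
  shows "winding_number \<gamma> w = indicator \<Omega> w"
proof (cases "w \<in> \<Omega>")
  case True
  then show ?thesis using \<Omega>(3) by (simp add: counterclockwise_def)
next
  case False
  have out: "winding_number \<gamma> v = 0" if "v \<in> outside (path_image \<gamma>)" for v
    using winding_number_zero_in_outside that \<gamma> simple_path_imp_path by blast
  have "w \<notin> inside (path_image \<gamma>)"
  proof
    assume w_in: "w \<in> inside (path_image \<gamma>)"
    have "\<Omega> \<noteq> {}" using \<Omega>(2) path_image_nonempty [of \<gamma>] by auto
    then obtain v where v: "v \<in> \<Omega>" by blast
    have "v \<notin> outside (path_image \<gamma>)"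
      using out [of v] \<Omega>(3) v by (auto simp: counterclockwise_def)
    moreover have "v \<notin> path_image \<gamma>"
      using \<Omega> v frontier_disjoint_eq by blast
    ultimately have "v \<in> inside (path_image \<gamma>)"
      using inside_Un_outside [of "path_image \<gamma>"] by blast
    moreover have "connected (inside (path_image \<gamma>))"
      using Jordan_inside_outside [OF \<gamma>] by blast
    ultimately have "inside (path_image \<gamma>) \<inter> frontier \<Omega> \<noteq> {}"
      using w_in v False by (intro connected_Int_frontier) auto
    then show False
      using \<Omega>(2) inside_no_overlap [of "path_image \<gamma>"] by auto
  qed
  then have "w \<in> outside (path_image \<gamma>)"
    using w inside_Un_outside [of "path_image \<gamma>"] by blast
  then show ?thesis
    using False out by simp
qed

text \<open>Integrating \<open>x y' + x' y\<close> over the closed curve gives zero, which brings the area formula into the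
symmetric form that appears when $|z - Rn|^2$ is expanded.\<close>

lemma area_eq_line_integral:
  assumes L: "L > 0" and closed: "z L = z 0"
    and deriv: "\<And>s. (z has_vector_derivative z' s) (at s)"
    and cont: "continuous_on UNIV z'"
    and simple: "simple_path (loop_of L z)"
    and \<Omega>: "open \<Omega>" "frontier \<Omega> = path_image (loop_of L z)" "counterclockwise \<Omega> (loop_of L z)"
    and meas: "\<Omega> \<in> lmeasurable"
  shows "((\<lambda>s. Re (z s) * Im (z' s) - Im (z s) * Re (z' s)) has_integral 2 * measure lebesgue \<Omega>) {0..L}"
proof -
  have path: "path_image (loop_of L z) = z ` {0..L}"
    by (rule path_image_loop_of [OF L])
  have loop: "pathfinish (loop_of L z) = pathstart (loop_of L z)"
    using closed by (simp add: pathfinish_def pathstart_def loop_of_def)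
  note wn = winding_number_eq_indicator [OF simple loop \<Omega>]
  have "bounded \<Omega>"
  proof -
    have "\<Omega> \<subseteq> inside (path_image (loop_of L z))"
    proof
      fix w assume w: "w \<in> \<Omega>"
      then have "w \<notin> path_image (loop_of L z)"
        using \<Omega>(1,2) frontier_disjoint_eq by blast
      moreover have "w \<notin> outside (path_image (loop_of L z))"
        using winding_number_zero_in_outside [OF simple_path_imp_path [OF simple] loop, of w] w \<Omega>(3)
        by (auto simp: counterclockwise_def)
      ultimately show "w \<in> inside (path_image (loop_of L z))"
        using inside_Un_outside [of "path_image (loop_of L z)"] by blast
    qed
    then show ?thesis
      using bounded_subset bounded_inside bounded_simple_path_image [OF simple] by blast
  qed
  have wn': "integral {0..L} (\<lambda>s. z' s / (z s - w)) = 2 * of_real pi * \<i> * indicator \<Omega> w"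
    if "w \<notin> z ` {0..L}" for w
    using winding_number_loop_of [OF L deriv cont that] wn [of w] that path by simp
  have y: "measure lebesgue \<Omega> = - integral {0..L} (\<lambda>s. Im (z s) * Re (z' s))"
    using L by (intro area_by_winding_integral [OF _ closed deriv cont meas \<open>bounded \<Omega>\<close> wn']) auto
  have cz: "continuous_on {0..L} z" "continuous_on {0..L} z'"
    using deriv by (auto intro: continuous_on_vector_derivative has_vector_derivative_at_within
        continuous_on_subset [OF cont])
  have yi: "((\<lambda>s. Im (z s) * Re (z' s)) has_integral - measure lebesgue \<Omega>) {0..L}"
    unfolding y using cz by (auto intro!: integrable_integral integrable_continuous_interval continuous_intros)
  have "((\<lambda>s. Re (z s) * Im (z s)) has_vector_derivative Re (z s) * Im (z' s) + Re (z' s) * Im (z s)) (at s within {0..L})" for s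
    using has_vector_derivative_mult [OF bounded_linear.has_vector_derivative [OF bounded_linear_Re]
        bounded_linear.has_vector_derivative [OF bounded_linear_Im],
        OF has_vector_derivative_at_within [OF deriv] has_vector_derivative_at_within [OF deriv]] .
  then have "((\<lambda>s. Re (z s) * Im (z' s) + Re (z' s) * Im (z s)) has_integral Re (z L) * Im (z L) - Re (z 0) * Im (z 0)) {0..L}"
    using L by (intro fundamental_theorem_of_calculus) auto
  then have "((\<lambda>s. Re (z s) * Im (z' s) + Re (z' s) * Im (z s)) has_integral 0) {0..L}"
    by (simp add: closed)
  from has_integral_diff [OF this has_integral_mult_right [OF yi, of 2]]
  show ?thesis by (simp add: algebra_simps)
qed

section \<open>The outward normal of a positively oriented curve\<close>

text \<open>Here \<open>g\<close> is the curve moved so that it passes through the origin at \<open>s\<^sub>0\<close> in the direction of the real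
axis, and the kernel is, up to a constant, the difference of the Cauchy kernels at the points
\<open>\<plusminus>\<i> \<epsilon>\<close>. For a straight line it is the Poisson kernel $\epsilon/(u^2+\epsilon^2)$, with integral close
to \<open>\<pi>\<close>. A \<open>C\<^sup>1\<close> curve is so close to its tangent near \<open>s\<^sub>0\<close> that a fixed fraction of the Poisson kernel
bounds the real part from below, and away from \<open>s\<^sub>0\<close> the kernel is \<open>O(\<epsilon>)\<close>.\<close>

lemma normal_crossing_kernel_positive:
  fixes g g' :: "real \<Rightarrow> complex"
  assumes s\<^sub>0: "0 < s\<^sub>0" "s\<^sub>0 < L"
    and deriv: "\<And>s. (g has_vector_derivative g' s) (at s)"
    and cont: "continuous_on UNIV g'"
    and at: "g s\<^sub>0 = 0" "g' s\<^sub>0 = 1"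
    and inj: "\<And>s. s \<in> {0..L} \<Longrightarrow> s \<noteq> s\<^sub>0 \<Longrightarrow> g s \<noteq> 0"
  shows "\<forall>\<^sub>F \<epsilon> in at_right 0. (\<forall>s\<in>{0..L}. (g s)\<^sup>2 + of_real (\<epsilon>\<^sup>2) \<noteq> 0) \<and>
    0 < Re (integral {0..L} (\<lambda>s. of_real \<epsilon> * g' s / ((g s)\<^sup>2 + of_real (\<epsilon>\<^sup>2))))"
proof -
  have cg: "continuous_on UNIV g"
    using deriv has_vector_derivative_continuous by (blast intro: continuous_at_imp_continuous_on)
  obtain \<delta> where \<delta>: "\<delta> > 0" "\<And>s. \<bar>s - s\<^sub>0\<bar> < \<delta> \<Longrightarrow> norm (g' s - 1) \<le> 1 / 10"
  proof -
    have "isCont g' s\<^sub>0" using cont by (simp add: continuous_on_eq_continuous_at)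
    then obtain d where "d > 0" "\<And>s. dist s s\<^sub>0 < d \<Longrightarrow> dist (g' s) (g' s\<^sub>0) < 1 / 10"
      unfolding continuous_at_eps_delta [unfolded dist_norm [symmetric]]
      by (metis zero_less_divide_1_iff zero_less_numeral)
    then show ?thesis using that [of d] by (force simp: dist_norm at)
  qed
  have near: "norm (g s - of_real (s - s\<^sub>0)) \<le> \<bar>s - s\<^sub>0\<bar> / 10" if s: "\<bar>s - s\<^sub>0\<bar> < \<delta>" for s
  proof -
    have "norm ((\<lambda>s. g s - of_real s) s - (\<lambda>s. g s - of_real s) s\<^sub>0) \<le> 1 / 10 * norm (s - s\<^sub>0)"
    proof (rule differentiable_bound [of "ball s\<^sub>0 \<delta>" _ "\<lambda>r h. h *\<^sub>R (g' r - 1)"])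
      fix r assume r: "r \<in> ball s\<^sub>0 \<delta>"
      have "((\<lambda>s. g s - of_real s) has_vector_derivative g' r - 1) (at r within ball s\<^sub>0 \<delta>)"
        using has_vector_derivative_diff [OF has_vector_derivative_at_within [OF deriv]
            has_vector_derivative_of_real [OF DERIV_ident]] by simp
      then show "((\<lambda>s. g s - of_real s) has_derivative (\<lambda>h. h *\<^sub>R (g' r - 1))) (at r within ball s\<^sub>0 \<delta>)"
        by (simp add: has_vector_derivative_def)
      show "onorm (\<lambda>h. h *\<^sub>R (g' r - 1)) \<le> 1 / 10"
      proof (rule onorm_le)
        fix h :: real
        have "norm (g' r - 1) \<le> 1 / 10"
          using \<delta>(2) [of r] r by (simp add: dist_real_def abs_minus_commute)
        from mult_left_mono [OF this abs_ge_zero [of h]]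
        show "norm (h *\<^sub>R (g' r - 1)) \<le> 1 / 10 * norm h" by simp
      qed
    qed (use s \<delta>(1) in \<open>auto simp: dist_real_def abs_minus_commute\<close>)
    then show ?thesis by (simp add: at algebra_simps)
  qed
  have "compact ({0..L} - ball s\<^sub>0 \<delta>)"
    by (intro compact_diff) auto
  then have "compact (g ` ({0..L} - ball s\<^sub>0 \<delta>))"
    using cg by (intro compact_continuous_image) (auto intro: continuous_on_subset)
  moreover have "0 \<notin> g ` ({0..L} - ball s\<^sub>0 \<delta>)"
    using inj \<delta>(1) by force
  ultimately obtain c where "c > 0" "\<And>v. v \<in> g ` ({0..L} - ball s\<^sub>0 \<delta>) \<Longrightarrow> c \<le> dist 0 v"
    using separate_point_closed compact_imp_closed by metis
  then have c: "c > 0" "\<And>s. s \<in> {0..L} \<Longrightarrow> \<delta> \<le> \<bar>s - s\<^sub>0\<bar> \<Longrightarrow> c \<le> norm (g s)"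
    by (auto simp: dist_real_def abs_minus_commute)
  have "compact (g' ` {0..L})"
    using cont by (intro compact_continuous_image) (auto intro: continuous_on_subset)
  then obtain B where B: "B > 0" "\<And>s. s \<in> {0..L} \<Longrightarrow> norm (g' s) \<le> B"
    using compact_imp_bounded [of "g' ` {0..L}"] unfolding bounded_pos by auto
  \<comment> \<open>The first term pays for the Poisson kernel away from \<open>s\<^sub>0\<close>, the second for the true kernel.\<close>
  define K where "K = 1 / \<delta>\<^sup>2 + 2 * B / c\<^sup>2"
  have K: "K > 0" unfolding K_def using B c \<delta> by (intro add_pos_pos divide_pos_pos) auto
  \<comment> \<open>The first two bounds make both arctangents at least \<open>\<pi>/4\<close>, the third keeps the denominator away from zero, and the last limits the total error to \<open>1/2\<close>.\<close>
  define \<epsilon>\<^sub>0 where "\<epsilon>\<^sub>0 = min (min s\<^sub>0 (L - s\<^sub>0)) (min (c / 2) (1 / (2 * K * L)))"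
  have "0 < 1 / (2 * K * L)" using s\<^sub>0 K by simp
  then have \<epsilon>\<^sub>0: "0 < \<epsilon>\<^sub>0" "\<epsilon>\<^sub>0 \<le> s\<^sub>0" "\<epsilon>\<^sub>0 \<le> L - s\<^sub>0" "\<epsilon>\<^sub>0 \<le> c / 2" "\<epsilon>\<^sub>0 \<le> 1 / (2 * K * L)"
    unfolding \<epsilon>\<^sub>0_def using s\<^sub>0 c(1) by linarith+
  have main: "(\<forall>s\<in>{0..L}. (g s)\<^sup>2 + of_real (\<epsilon>\<^sup>2) \<noteq> 0) \<and>
      0 < Re (integral {0..L} (\<lambda>s. of_real \<epsilon> * g' s / ((g s)\<^sup>2 + of_real (\<epsilon>\<^sup>2))))"
    if \<epsilon>: "0 < \<epsilon>" "\<epsilon> < \<epsilon>\<^sub>0" for \<epsilon>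
  proof -
    let ?f = "\<lambda>s. of_real \<epsilon> * g' s / ((g s)\<^sup>2 + of_real (\<epsilon>\<^sup>2))"
    have bound: "(g s)\<^sup>2 + of_real (\<epsilon>\<^sup>2) \<noteq> 0 \<and>
        3 / 5 * (\<epsilon> / ((s - s\<^sub>0)\<^sup>2 + \<epsilon>\<^sup>2)) - K * \<epsilon> \<le> Re (?f s)" if s: "s \<in> {0..L}" for s
    proof (cases "\<bar>s - s\<^sub>0\<bar> < \<delta>")
      case True
      define u where "u = s - s\<^sub>0"
      define q where "q = u\<^sup>2 + \<epsilon>\<^sup>2"
      have q: "q > 0" unfolding q_def using \<epsilon> by (intro add_nonneg_pos) auto
      \<comment> \<open>Relative errors: the denominator is \<open>q (1 + \<theta>)\<close>, compared with the Poisson denominator \<open>q\<close>.\<close>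
      define \<theta> where "\<theta> = ((g s)\<^sup>2 - of_real (u\<^sup>2)) / of_real q"
      have gu: "norm (g s - of_real u) \<le> \<bar>u\<bar> / 10"
        using near [OF True] by (simp add: u_def)
      have "norm (g s + of_real u) \<le> norm (g s - of_real u) + norm (2 * of_real u :: complex)"
        using norm_triangle_ineq [of "g s - of_real u" "2 * of_real u"] by (simp add: algebra_simps)
      also have "\<dots> \<le> 21 / 10 * \<bar>u\<bar>" using gu by (simp add: norm_mult)
      finally have gu': "norm (g s + of_real u) \<le> 21 / 10 * \<bar>u\<bar>" .
      have "norm ((g s)\<^sup>2 - of_real (u\<^sup>2)) = norm (g s - of_real u) * norm (g s + of_real u)"
        by (simp add: norm_mult [symmetric] power2_eq_square algebra_simps)
      also have "\<dots> \<le> (\<bar>u\<bar> / 10) * (21 / 10 * \<bar>u\<bar>)"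
        using gu gu' by (intro mult_mono) auto
      also have "\<dots> = 21 / 100 * u\<^sup>2" by (simp add: power2_eq_square abs_mult [symmetric])
      also have "\<dots> \<le> 21 / 100 * q" by (simp add: q_def)
      finally have \<theta>: "norm \<theta> \<le> 21 / 100"
        using q by (simp add: \<theta>_def norm_divide divide_le_eq)
      have \<theta>1: "79 / 100 \<le> norm (1 + \<theta>)"
        using norm_diff_ineq [of 1 \<theta>] \<theta> by simp
      then have nz: "1 + \<theta> \<noteq> 0" by auto
      have den: "(g s)\<^sup>2 + of_real (\<epsilon>\<^sup>2) = of_real q * (1 + \<theta>)"
      proof -
        have "of_real q * \<theta> = (g s)\<^sup>2 - of_real (u\<^sup>2)"
          using q by (simp add: \<theta>_def)
        then show ?thesis by (simp add: distrib_left q_def)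
      qed
      have "norm (g' s / (1 + \<theta>) - 1) = norm ((g' s - 1) - \<theta>) / norm (1 + \<theta>)"
        using nz by (simp add: norm_divide [symmetric] divide_simps diff_diff_eq)
      also have "\<dots> \<le> (31 / 100) / (79 / 100)"
        using \<delta>(2) [OF True] \<theta> \<theta>1 norm_triangle_ineq4 [of "g' s - 1" \<theta>]
        by (intro frac_le) auto
      finally have "norm (g' s / (1 + \<theta>) - 1) \<le> 2 / 5" by simp
      then have "3 / 5 \<le> Re (g' s / (1 + \<theta>))"
        using abs_Re_le_cmod [of "g' s / (1 + \<theta>) - 1"] by simp
      then have "3 / 5 * (\<epsilon> / q) \<le> Re (of_real (\<epsilon> / q) * (g' s / (1 + \<theta>)))"
      proof -
        have "Re (of_real r * v) = r * Re v" for r v by simp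
        then show ?thesis
          using \<epsilon> q \<open>3 / 5 \<le> _\<close> mult_left_mono [of "3 / 5" "Re (g' s / (1 + \<theta>))" "\<epsilon> / q"]
          by (simp only: mult.commute [of "3 / 5"]) simp
      qed
      also have "of_real (\<epsilon> / q) * (g' s / (1 + \<theta>)) = ?f s"
        unfolding den using q nz by simp
      finally have "3 / 5 * (\<epsilon> / q) \<le> Re (?f s)" .
      moreover have "0 \<le> K * \<epsilon>" using K \<epsilon> by simp
      ultimately have "3 / 5 * (\<epsilon> / q) - K * \<epsilon> \<le> Re (?f s)" by linarith
      moreover have "(g s)\<^sup>2 + of_real (\<epsilon>\<^sup>2) \<noteq> 0"
        unfolding den using q nz by simp
      ultimately show ?thesis
        unfolding q_def u_def by blast
    next
      case False
      have cg: "c \<le> norm (g s)" using c(2) s False by simp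
      have "\<epsilon> \<le> c / 2" using \<epsilon> \<epsilon>\<^sub>0 by simp
      then have "\<epsilon>\<^sup>2 \<le> (c / 2)\<^sup>2" using \<epsilon> by (intro power_mono) auto
      then have "\<epsilon>\<^sup>2 \<le> c\<^sup>2 / 4" by (simp add: power_divide)
      moreover have "0 \<le> c\<^sup>2" by simp
      moreover have "c\<^sup>2 \<le> (norm (g s))\<^sup>2" using cg c by (intro power_mono) auto
      moreover have "(norm (g s))\<^sup>2 - \<epsilon>\<^sup>2 \<le> norm ((g s)\<^sup>2 + of_real (\<epsilon>\<^sup>2))"
        using norm_diff_ineq [of "(g s)\<^sup>2" "of_real (\<epsilon>\<^sup>2)"] by (simp add: norm_power)
      ultimately have den: "c\<^sup>2 / 2 \<le> norm ((g s)\<^sup>2 + of_real (\<epsilon>\<^sup>2))"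
        by linarith
      then have nz: "(g s)\<^sup>2 + of_real (\<epsilon>\<^sup>2) \<noteq> 0" using c by auto
      have "norm (?f s) \<le> \<epsilon> * B / (c\<^sup>2 / 2)"
        unfolding norm_divide norm_mult using \<epsilon> B s c den by (intro frac_le mult_mono) auto
      then have f: "- (\<epsilon> * (2 * B / c\<^sup>2)) \<le> Re (?f s)"
        using abs_Re_le_cmod [of "?f s"] by simp
      have "\<delta>\<^sup>2 \<le> (s - s\<^sub>0)\<^sup>2" using False \<delta>(1) by (simp add: abs_le_square_iff [symmetric])
      then have "\<delta>\<^sup>2 \<le> (s - s\<^sub>0)\<^sup>2 + \<epsilon>\<^sup>2" by (simp add: add_increasing2)
      then have "\<epsilon> / ((s - s\<^sub>0)\<^sup>2 + \<epsilon>\<^sup>2) \<le> \<epsilon> / \<delta>\<^sup>2"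
        using \<epsilon> \<delta>(1) by (intro frac_le) auto
      moreover have "0 \<le> \<epsilon> / ((s - s\<^sub>0)\<^sup>2 + \<epsilon>\<^sup>2)" using \<epsilon> by simp
      ultimately have "3 / 5 * (\<epsilon> / ((s - s\<^sub>0)\<^sup>2 + \<epsilon>\<^sup>2)) \<le> \<epsilon> / \<delta>\<^sup>2" by linarith
      moreover have "K * \<epsilon> = \<epsilon> / \<delta>\<^sup>2 + \<epsilon> * (2 * B / c\<^sup>2)" by (simp add: K_def algebra_simps)
      ultimately have "3 / 5 * (\<epsilon> / ((s - s\<^sub>0)\<^sup>2 + \<epsilon>\<^sup>2)) - K * \<epsilon> \<le> Re (?f s)" using f by linarith
      with nz show ?thesis by blast
    qed
    have atan: "((\<lambda>s. \<epsilon> / ((s - s\<^sub>0)\<^sup>2 + \<epsilon>\<^sup>2)) has_integral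
        arctan ((L - s\<^sub>0) / \<epsilon>) - arctan ((0 - s\<^sub>0) / \<epsilon>)) {0..L}"
    proof (rule fundamental_theorem_of_calculus)
      fix s
      have "((\<lambda>s. arctan ((s - s\<^sub>0) / \<epsilon>)) has_real_derivative \<epsilon> / ((s - s\<^sub>0)\<^sup>2 + \<epsilon>\<^sup>2)) (at s within {0..L})"
        using \<epsilon> by (auto intro!: derivative_eq_intros simp: divide_simps power2_eq_square add_nonneg_eq_0_iff)
      then show "((\<lambda>s. arctan ((s - s\<^sub>0) / \<epsilon>)) has_vector_derivative \<epsilon> / ((s - s\<^sub>0)\<^sup>2 + \<epsilon>\<^sup>2)) (at s within {0..L})"
        by (simp add: has_real_derivative_iff_has_vector_derivative)
    qed (use s\<^sub>0 in auto)
    have "continuous_on {0..L} ?f"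
      using bound by (intro continuous_intros continuous_on_subset [OF cg] continuous_on_subset [OF cont]) auto
    then have "(?f has_integral integral {0..L} ?f) {0..L}"
      by (intro integrable_integral integrable_continuous_interval)
    then have Ref: "((\<lambda>s. Re (?f s)) has_integral Re (integral {0..L} ?f)) {0..L}"
      by (rule has_integral_Re)
    have "((\<lambda>s. K * \<epsilon>) has_integral L * (K * \<epsilon>)) {0..L}"
      using has_integral_const_real [of "K * \<epsilon>" 0 L] s\<^sub>0 by simp
    then have "((\<lambda>s. 3 / 5 * (\<epsilon> / ((s - s\<^sub>0)\<^sup>2 + \<epsilon>\<^sup>2)) - K * \<epsilon>) has_integral
        3 / 5 * (arctan ((L - s\<^sub>0) / \<epsilon>) - arctan ((0 - s\<^sub>0) / \<epsilon>)) - L * (K * \<epsilon>)) {0..L}"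
      by (intro has_integral_diff has_integral_mult_right atan)
    from has_integral_le [OF this Ref] bound
    have "3 / 5 * (arctan ((L - s\<^sub>0) / \<epsilon>) - arctan ((0 - s\<^sub>0) / \<epsilon>)) - L * (K * \<epsilon>) \<le> Re (integral {0..L} ?f)"
      by simp
    moreover have "pi / 4 \<le> arctan ((L - s\<^sub>0) / \<epsilon>)" "pi / 4 \<le> arctan (s\<^sub>0 / \<epsilon>)"
      unfolding arctan_one [symmetric] arctan_le_iff using \<epsilon> \<epsilon>\<^sub>0 by (auto simp: le_divide_eq)
    moreover have "arctan ((0 - s\<^sub>0) / \<epsilon>) = - arctan (s\<^sub>0 / \<epsilon>)"
      by (simp add: arctan_minus [symmetric])
    moreover have "L * (K * \<epsilon>) \<le> 1 / 2"
    proof -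
      have "L * K > 0" using s\<^sub>0 K by simp
      moreover have "\<epsilon> \<le> 1 / (2 * K * L)" using \<epsilon> \<epsilon>\<^sub>0 by simp
      ultimately show ?thesis by (simp add: field_simps)
    qed
    moreover have "pi > 3" by (rule pi_gt3)
    ultimately have "0 < Re (integral {0..L} ?f)" by argo
    then show ?thesis using bound by blast
  qed
  show ?thesis
    unfolding eventually_at_right_field using main \<epsilon>\<^sub>0(1) by blast
qed

text \<open>A unit vector orthogonal to \<open>z'\<close> is \<open>\<i> z'\<close> or \<open>-\<i> z'\<close>. If \<open>\<i> z'\<close> were outward, the winding number would be zero just
to the left of the curve; but it is larger there than just to the right, where it is at least zero.
Keeping \<open>s\<^sub>0\<close> strictly between \<open>0\<close> and \<open>L\<close> ensures that the curve near \<open>z s\<^sub>0\<close> corresponds to one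
interval inside the period.\<close>

lemma outward_unit_normal_eq:
  assumes L: "L > 0"
    and deriv: "\<And>s. (z has_vector_derivative z' s) (at s)"
    and cont: "continuous_on UNIV z'"
    and unit: "\<And>s. norm (z' s) = 1"
    and closed: "z L = z 0"
    and simple: "simple_path (loop_of L z)"
    and \<Omega>: "open \<Omega>" "frontier \<Omega> = path_image (loop_of L z)" "counterclockwise \<Omega> (loop_of L z)"
    and s\<^sub>0: "0 < s\<^sub>0" "s\<^sub>0 < L"
    and normal: "outward_unit_normal \<Omega> z s\<^sub>0 \<nu>"
  shows "\<nu> = - \<i> * z' s\<^sub>0"
proof (rule ccontr)
  assume neq: "\<nu> \<noteq> - \<i> * z' s\<^sub>0"
  define \<tau> where "\<tau> = z' s\<^sub>0"
  have \<tau>: "norm \<tau> = 1" "\<tau> \<noteq> 0" using unit [of s\<^sub>0] by (auto simp: \<tau>_def)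
  have \<nu>: "\<nu> = \<i> * \<tau>"
  proof -
    have "norm \<nu> = 1" "\<nu> \<bullet> \<tau> = 0"
      using normal vector_derivative_at [OF deriv] by (auto simp: outward_unit_normal_def \<tau>_def)
    define r where "r = \<nu> * cnj \<tau>"
    have "Re r = 0" using \<open>\<nu> \<bullet> \<tau> = 0\<close> by (simp add: r_def inner_complex_def)
    moreover have "norm r = 1" using \<open>norm \<nu> = 1\<close> \<tau> by (simp add: r_def norm_mult)
    ultimately have "\<bar>Im r\<bar> = 1" by (simp add: cmod_eq_Im)
    then have "r = \<i> \<or> r = - \<i>" using \<open>Re r = 0\<close> by (auto simp: complex_eq_iff abs_if split: if_splits)
    moreover have "\<nu> = r * \<tau>"
      using \<tau> by (simp add: r_def mult.assoc mult.commute [of "cnj \<tau>"] flip: complex_norm_square)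
    ultimately show ?thesis using neq by (auto simp: \<tau>_def)
  qed
  define p where "p = z s\<^sub>0"
  define g where "g s = (z s - p) / \<tau>" for s
  have wn: "winding_number (loop_of L z) w = indicator \<Omega> w" if "w \<notin> z ` {0..L}" for w
    using winding_number_eq_indicator [OF simple _ \<Omega>] that path_image_loop_of [OF L] closed
    by (simp add: pathfinish_def pathstart_def loop_of_def)
  have inj: "z s \<noteq> p" if "s \<in> {0..L}" "s \<noteq> s\<^sub>0" for s
  proof
    assume "z s = p"
    then have "loop_of L z (s / L) = loop_of L z (s\<^sub>0 / L)"
      using L by (simp add: loop_of_def p_def)
    then show False
      using simple that s\<^sub>0 L unfolding simple_path_def loop_free_def
      by (fastforce simp: divide_simps)
  qed
  have "\<forall>\<^sub>F \<epsilon> in at_right 0. (\<forall>s\<in>{0..L}. (g s)\<^sup>2 + of_real (\<epsilon>\<^sup>2) \<noteq> 0) \<and>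
    0 < Re (integral {0..L} (\<lambda>s. of_real \<epsilon> * (z' s / \<tau>) / ((g s)\<^sup>2 + of_real (\<epsilon>\<^sup>2))))"
  proof (rule normal_crossing_kernel_positive [OF s\<^sub>0])
    show "(g has_vector_derivative z' s / \<tau>) (at s)" for s
      unfolding g_def by (intro has_vector_derivative_divide has_vector_derivative_diff_const [THEN iffD2] deriv)
    show "continuous_on UNIV (\<lambda>s. z' s / \<tau>)"
      using \<tau> by (intro continuous_intros cont) simp
  qed (use \<tau> inj in \<open>auto simp: g_def p_def \<tau>_def\<close>)
  moreover have "\<forall>\<^sub>F \<epsilon> in at_right 0. p + \<epsilon> *\<^sub>R \<nu> \<notin> closure \<Omega>"
    using normal by (simp add: outward_unit_normal_def p_def)
  moreover have "\<forall>\<^sub>F \<epsilon>::real in at_right 0. \<epsilon> > 0"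
    by (simp add: eventually_at_right_less)
  ultimately have "\<forall>\<^sub>F \<epsilon>::real in at_right 0. False"
  proof eventually_elim
    case (elim \<epsilon>)
    let ?a = "p + \<epsilon> *\<^sub>R \<nu>" and ?b = "p - \<epsilon> *\<^sub>R \<nu>"
    \<comment> \<open>The two points are \<open>p \<plusminus> \<i> \<epsilon> \<tau>\<close>, so the product of the two factors is \<open>(z s - p)\<^sup>2 + \<epsilon>\<^sup>2 \<tau>\<^sup>2\<close>.\<close>
    have fac: "(z s - ?a) * (z s - ?b) = \<tau>\<^sup>2 * ((g s)\<^sup>2 + of_real (\<epsilon>\<^sup>2))" for s
    proof -
      have "(z s - ?a) * (z s - ?b) = (z s - p)\<^sup>2 + \<tau>\<^sup>2 * of_real (\<epsilon>\<^sup>2)"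
        by (simp add: \<nu> power2_eq_square scaleR_conv_of_real algebra_simps)
      then show ?thesis using \<tau>(2) by (simp add: g_def power_divide distrib_left)
    qed
    have nz: "z s - ?a \<noteq> 0" "z s - ?b \<noteq> 0" if "s \<in> {0..L}" for s
    proof -
      have "(z s - ?a) * (z s - ?b) \<noteq> 0"
        unfolding fac using elim(1) that \<tau>(2) by simp
      then show "z s - ?a \<noteq> 0" "z s - ?b \<noteq> 0"
        by (simp_all only: mult_eq_0_iff simp_thms de_Morgan_disj)
    qed
    have off: "?a \<notin> z ` {0..L}" "?b \<notin> z ` {0..L}"
      using nz unfolding image_iff by (metis right_minus_eq)+
    have cz: "continuous_on {0..L} z" "continuous_on {0..L} z'"
      using deriv by (auto intro: continuous_on_vector_derivative has_vector_derivative_at_within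
          continuous_on_subset [OF cont])
    have "2 * of_real pi * \<i> * (winding_number (loop_of L z) ?a - winding_number (loop_of L z) ?b)
        = integral {0..L} (\<lambda>s. z' s / (z s - ?a)) - integral {0..L} (\<lambda>s. z' s / (z s - ?b))"
      using winding_number_loop_of [OF L deriv cont] off by (simp add: right_diff_distrib)
    also have "\<dots> = integral {0..L} (\<lambda>s. z' s / (z s - ?a) - z' s / (z s - ?b))"
      using nz by (intro integral_diff [symmetric] integrable_continuous_interval continuous_intros cz) auto
    also have "\<dots> = integral {0..L} (\<lambda>s. 2 * \<i> * (of_real \<epsilon> * (z' s / \<tau>) / ((g s)\<^sup>2 + of_real (\<epsilon>\<^sup>2))))"
    proof (rule integral_cong)
      fix s assume s: "s \<in> {0..L}"
      have "z' s / (z s - ?a) - z' s / (z s - ?b) = z' s * (?a - ?b) / ((z s - ?a) * (z s - ?b))"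
        using nz [OF s] by (simp add: diff_frac_eq algebra_simps)
      also have "\<dots> = 2 * \<i> * (of_real \<epsilon> * (z' s / \<tau>) / ((g s)\<^sup>2 + of_real (\<epsilon>\<^sup>2)))"
        unfolding fac using \<tau>(2) by (simp add: \<nu> scaleR_conv_of_real power2_eq_square)
      finally show "z' s / (z s - ?a) - z' s / (z s - ?b)
          = 2 * \<i> * (of_real \<epsilon> * (z' s / \<tau>) / ((g s)\<^sup>2 + of_real (\<epsilon>\<^sup>2)))" .
    qed
    also have "\<dots> = 2 * \<i> * integral {0..L} (\<lambda>s. of_real \<epsilon> * (z' s / \<tau>) / ((g s)\<^sup>2 + of_real (\<epsilon>\<^sup>2)))"
      by (rule integral_mult_right)
    finally have "of_real pi * (winding_number (loop_of L z) ?a - winding_number (loop_of L z) ?b)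
        = integral {0..L} (\<lambda>s. of_real \<epsilon> * (z' s / \<tau>) / ((g s)\<^sup>2 + of_real (\<epsilon>\<^sup>2)))"
      by simp
    then have "0 < Re (of_real pi * (winding_number (loop_of L z) ?a - winding_number (loop_of L z) ?b))"
      using elim(1) by simp
    moreover have "?a \<notin> \<Omega>" using elim(2) closure_subset by blast
    ultimately show ?case
      using wn [OF off(1)] wn [OF off(2)] by (cases "?b \<in> \<Omega>") auto
  qed
  then show False by simp
qed

section \<open>The polynomials P and S\<close>

lemma poly_P_poly: "poly (P_poly m) x = (\<Prod>j=2..m. x - (real j)\<^sup>2)"
  by (simp add: P_poly_def poly_prod)

lemma poly_P_poly_1:
  assumes "m \<ge> 1"
  shows "poly (P_poly m) 1 = - ((- 1) ^ m / 2 * fact (m - 1) * fact (m + 1))"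
  using assms
proof (induction m rule: nat_induct_at_least)
  case base
  then show ?case by (simp add: P_poly_def fact_numeral)
next
  case (Suc m)
  have "poly (P_poly (Suc m)) 1 = poly (P_poly m) 1 * (1 - (real (Suc m))\<^sup>2)"
    unfolding poly_P_poly using Suc.hyps by (simp add: prod.nat_ivl_Suc')
  also have "\<dots> = (- 1) ^ m / 2 * (real m * fact (m - 1)) * (real (m + 2) * fact (m + 1))"
  proof -
    have "1 - (real (Suc m))\<^sup>2 = - (real m * real (m + 2))"
      by (simp add: power2_eq_square algebra_simps)
    moreover have "- (a * b * c) * - (x * y) = a * (x * b) * (y * c)" for a b c x y :: real
      by simp
    ultimately show ?thesis unfolding Suc.IH by simp
  qed
  also have "real m * fact (m - 1) = fact m"
    using Suc.hyps by (simp add: fact_reduce)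
  also have "real (m + 2) * fact (m + 1) = fact (Suc m + 1)"
    by (simp add: algebra_simps)
  finally show ?case by simp
qed

text \<open>For \<open>m = 1\<close> the polynomial \<open>S\<close> is zero and the bound \<open>m - 1\<close> is zero too, whence the disjunction.\<close>

lemma degree_S_poly_less: "S_poly m = 0 \<or> degree (S_poly m) < m - 1"
proof (cases "S_poly m = 0")
  case False
  have "degree (P_poly m) \<le> (\<Sum>j=2..m. 1)"
    unfolding P_poly_def
    by (rule order_trans [OF degree_prod_sum_le]) (auto intro!: sum_mono)
  then have "degree (P_poly m - [:poly (P_poly m) 1:]) \<le> m - 1"
    by (intro degree_diff_le) auto
  then have "degree ([:- 1, 1:] * S_poly m) \<le> m - 1"
    by (simp only: S_poly_exact)
  then show ?thesis
    using False by (subst (asm) degree_mult_eq) auto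
qed simp

lemma sum_s_coeff: "(\<Sum>l=1..m-1. s_coeff m l * x ^ (l - 1)) = poly (S_poly m) x"
proof -
  have "(\<Sum>l=1..m-1. s_coeff m l * x ^ (l - 1)) = (\<Sum>i<m-1. coeff (S_poly m) i * x ^ i)"
    by (rule sum.reindex_bij_witness [of _ Suc "\<lambda>l. l - 1"]) (auto simp: s_coeff_def)
  also have "\<dots> = (\<Sum>i\<le>degree (S_poly m). coeff (S_poly m) i * x ^ i)"
  proof (cases "S_poly m = 0")
    case False
    then show ?thesis
      using degree_S_poly_less [of m]
      by (intro sum.mono_neutral_right) (auto simp: coeff_eq_0)
  qed simp
  finally show ?thesis by (simp only: poly_altdef)
qed

lemma P_poly_eq_S_poly: "poly (P_poly m) x = (x - 1) * poly (S_poly m) x + poly (P_poly m) 1"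
  using arg_cong [OF S_poly_exact, of "\<lambda>p. poly p x" m] by (simp add: algebra_simps)

text \<open>Up to the factor \<open>2\<pi>\<close>, the weight of $|c_k|^2$ in the quadratic form.\<close>

definition mode_weight :: "nat \<Rightarrow> int \<Rightarrow> real"
  where "mode_weight m k = (\<Prod>j=1..m. (real_of_int k)\<^sup>2 - (real j)\<^sup>2)"

lemma mode_weight_eq:
  assumes "m \<ge> 1"
  shows "mode_weight m k = ((real_of_int k)\<^sup>2 - 1) * poly (P_poly m) ((real_of_int k)\<^sup>2)"
  unfolding mode_weight_def poly_P_poly using assms by (subst prod.atLeast_Suc_atMost) (auto simp: numeral_2_eq_2)

lemma mode_weight_pos:
  assumes "\<bar>k\<bar> > int m"
  shows "mode_weight m k > 0"
  unfolding mode_weight_def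
proof (intro prod_pos)
  fix j assume "j \<in> {1..m}"
  then have "int j < \<bar>k\<bar>" using assms by simp
  then have "real_of_int (int j) < real_of_int \<bar>k\<bar>" by (simp only: of_int_less_iff)
  then have "real j < \<bar>real_of_int k\<bar>" by simp
  then have "(real j)\<^sup>2 < \<bar>real_of_int k\<bar>\<^sup>2" by (intro power_strict_mono) auto
  then show "0 < (real_of_int k)\<^sup>2 - (real j)\<^sup>2" by simp
qed

lemma mode_weight_0:
  assumes "k \<noteq> 0" "\<bar>k\<bar> \<le> int m"
  shows "mode_weight m k = 0"
proof -
  have "nat \<bar>k\<bar> \<in> {1..m}" using assms by auto
  moreover have "(real_of_int k)\<^sup>2 - (real (nat \<bar>k\<bar>))\<^sup>2 = 0" by simp
  ultimately show ?thesis unfolding mode_weight_def by (intro prod_zero bexI [of _ "nat \<bar>k\<bar>"]) auto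
qed

lemma mode_weight_nonneg: "k \<noteq> 0 \<Longrightarrow> mode_weight m k \<ge> 0"
  using mode_weight_pos [of m k] mode_weight_0 [of k m] by (cases "\<bar>k\<bar> \<le> int m") auto

section \<open>The inequality as a sum over frequencies\<close>

lemma has_sum_finite_sum:
  fixes f :: "'i \<Rightarrow> 'a \<Rightarrow> real"
  assumes "finite I" "\<And>i. i \<in> I \<Longrightarrow> (f i has_sum s i) A"
  shows "((\<lambda>x. \<Sum>i\<in>I. f i x) has_sum (\<Sum>i\<in>I. s i)) A"
  using assms by (induction I rule: finite_induct) (auto intro: has_sum_add)

text \<open>Since the speed is one, $|z - Rn|^2 = |z|^2 + R^2 - 2R\,(x y' - y x')$, and the last term integrates to
\<open>-4RF\<close>. The area then cancels and the difference equals $R\int|z'|^2 - R^{-1}\int|z|^2$, a Wirtinger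
deficit.\<close>

lemma isoperimetric_defect_has_sum:
  fixes z n :: "real \<Rightarrow> complex"
  assumes L: "L > 0" and per: "\<And>s. z (s + L) = z s" and z: "Ck m z" "m \<ge> 1"
    and unit: "\<And>s. norm (iterated_derivative 1 z s) = 1"
    and normal: "\<And>s. 0 < s \<Longrightarrow> s < L \<Longrightarrow> n s = - \<i> * iterated_derivative 1 z s"
    and area: "((\<lambda>s. Re (z s) * Im (iterated_derivative 1 z s) - Im (z s) * Re (iterated_derivative 1 z s))
      has_integral 2 * F) {0..L}"
  shows "((\<lambda>k. 2 * pi * (((of_int k)\<^sup>2 - 1) * (norm (fourier_coeff L z k))\<^sup>2)) has_sum
    1 / pi * (L\<^sup>2 - 4 * pi * F) - 2 * pi / L * integral {0..L} (\<lambda>s. (norm (z s - (L / (2 * pi)) *\<^sub>R n s))\<^sup>2)) UNIV"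
proof -
  let ?z' = "iterated_derivative 1 z"
  define R where "R = L / (2 * pi)"
  have R: "R > 0" "L = 2 * pi * R" using L by (auto simp: R_def)
  let ?I = "integral {0..L} (\<lambda>s. (norm (z s))\<^sup>2)"
  have cz: "continuous_on {0..L} z"
    using Ck_continuous [OF z(1), of 0] continuous_on_subset by auto
  have I: "((\<lambda>s. (norm (z s))\<^sup>2) has_integral ?I) {0..L}"
    by (intro integrable_integral integrable_continuous_interval continuous_intros cz)
  have one: "((\<lambda>s. R\<^sup>2) has_integral L * R\<^sup>2) {0..L}"
    using has_integral_const_real [of "R\<^sup>2" 0 L] L by simp
  \<comment> \<open>The integrand is known only for \<open>0 < s < L\<close>, where the normal is determined.\<close>
  have expand: "(norm (z s - R *\<^sub>R n s))\<^sup>2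
      = (norm (z s))\<^sup>2 + R\<^sup>2 - 2 * R * (Re (z s) * Im (?z' s) - Im (z s) * Re (?z' s))"
    if "0 < s" "s < L" for s
  proof -
    have "(Re (?z' s))\<^sup>2 + (Im (?z' s))\<^sup>2 = 1"
      using unit [of s] by (simp add: cmod_power2 [symmetric])
    then have "R\<^sup>2 * ((Re (?z' s))\<^sup>2 + (Im (?z' s))\<^sup>2) = R\<^sup>2" by simp
    then show ?thesis
      unfolding normal [OF that] cmod_power2
      by (simp add: power2_eq_square algebra_simps)
  qed
  have "((\<lambda>s. (norm (z s))\<^sup>2 + R\<^sup>2 - 2 * R * (Re (z s) * Im (?z' s) - Im (z s) * Re (?z' s)))
      has_integral ?I + L * R\<^sup>2 - 2 * R * (2 * F)) {0..L}"
    by (intro has_integral_diff has_integral_add has_integral_mult_right area I one)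
  then have "((\<lambda>s. (norm (z s - R *\<^sub>R n s))\<^sup>2) has_integral ?I + L * R\<^sup>2 - 2 * R * (2 * F)) {0..L}"
    by (rule has_integral_spike_finite [of "{0, L}", rotated 2]) (use expand in auto)
  then have "integral {0..L} (\<lambda>s. (norm (z s - R *\<^sub>R n s))\<^sup>2) = ?I + L * R\<^sup>2 - 4 * R * F"
    by (simp add: integral_unique)
  moreover have "1 / pi * (L\<^sup>2 - 4 * pi * F) - 2 * pi / L * (I + L * R\<^sup>2 - 4 * R * F) = R * L + - (1 / R) * I" for I
    using R(1) unfolding R(2) by (simp add: field_simps power2_eq_square)
  ultimately have bracket: "1 / pi * (L\<^sup>2 - 4 * pi * F) - 2 * pi / L * integral {0..L} (\<lambda>s. (norm (z s - R *\<^sub>R n s))\<^sup>2)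
      = R * L + - (1 / R) * ?I"
    by (simp only:)
  have "((\<lambda>k. L * ((2 * pi * of_int k / L)\<^sup>2) ^ 1 * (norm (fourier_coeff L z k))\<^sup>2) has_sum integral {0..L} (\<lambda>s. (norm (?z' s))\<^sup>2)) UNIV"
    by (rule parseval_iterated_derivative [OF L z(1) per z(2)])
  moreover have "integral {0..L} (\<lambda>s. (norm (?z' s))\<^sup>2) = L"
    unfolding unit using L by simp
  ultimately have "((\<lambda>k. R * (L * ((2 * pi * of_int k / L)\<^sup>2) ^ 1 * (norm (fourier_coeff L z k))\<^sup>2)) has_sum R * L) UNIV"
    by (intro has_sum_cmult_right) simp
  moreover have "((\<lambda>k. - (1 / R) * (L * (norm (fourier_coeff L z k))\<^sup>2)) has_sum - (1 / R) * ?I) UNIV"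
    using parseval_iterated_derivative [OF L z(1) per, of 0] by (intro has_sum_cmult_right) simp
  ultimately have "((\<lambda>k. R * (L * ((2 * pi * of_int k / L)\<^sup>2) ^ 1 * (norm (fourier_coeff L z k))\<^sup>2)
      + - (1 / R) * (L * (norm (fourier_coeff L z k))\<^sup>2)) has_sum R * L + - (1 / R) * ?I) UNIV"
    by (rule has_sum_add)
  moreover have "R * (L * ((2 * pi * of_int k / L)\<^sup>2) ^ 1 * c) + - (1 / R) * (L * c) = 2 * pi * (((of_int k)\<^sup>2 - 1) * c)" for k c
    using R(1) unfolding R(2) by (simp add: field_simps power2_eq_square)
  ultimately have "((\<lambda>k. 2 * pi * (((of_int k)\<^sup>2 - 1) * (norm (fourier_coeff L z k))\<^sup>2)) has_sum R * L + - (1 / R) * ?I) UNIV"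
    by (simp only:)
  then show ?thesis
    unfolding R_def [symmetric] bracket .
qed

text \<open>All powers of \<open>R\<close> cancel: \<open>l - 1\<close> derivatives contribute $R^{-2(l-1)}$, the length element \<open>R\<close>, and
the prefactor $R^{2l-3}$.\<close>

lemma energy_has_sum:
  fixes z n :: "real \<Rightarrow> complex"
  assumes L: "L > 0" and per: "\<And>s. z (s + L) = z s" and z: "Ck m z" "m \<ge> 1"
    and unit: "\<And>s. norm (iterated_derivative 1 z s) = 1"
    and normal: "\<And>s. 0 < s \<Longrightarrow> s < L \<Longrightarrow> n s = - \<i> * iterated_derivative 1 z s"
    and area: "((\<lambda>s. Re (z s) * Im (iterated_derivative 1 z s) - Im (z s) * Re (iterated_derivative 1 z s))
      has_integral 2 * F) {0..L}"
  shows "((\<lambda>k. 2 * pi * (mode_weight m k * (norm (fourier_coeff L z k))\<^sup>2)) has_sum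
      (\<Sum>l=1..m-1. s_coeff m l * (L / (2 * pi)) powi (2 * int l - 3) *
        integral {0..L} (\<lambda>s. (norm (iterated_derivative (l - 1)
          (\<lambda>r. z r + (L / (2 * pi))\<^sup>2 *\<^sub>R curvature_vector z r) s))\<^sup>2))
      - (- 1) ^ m / 2 * fact (m - 1) * fact (m + 1) *
        (1 / pi * (L\<^sup>2 - 4 * pi * F)
         - 2 * pi / L * integral {0..L} (\<lambda>s. (norm (z s - (L / (2 * pi)) *\<^sub>R n s))\<^sup>2))) UNIV"
    (is "(_ has_sum ?A - ?c * ?X) UNIV")
proof -
  define R where "R = L / (2 * pi)"
  have R: "R > 0" "L = 2 * pi * R" using L by (auto simp: R_def)
  define c where "c k = (norm (fourier_coeff L z k))\<^sup>2" for k
  have scale: "R powi (2 * int l - 3) * (L * ((2 * pi * of_int k / L)\<^sup>2) ^ (l - 1)) = 2 * pi * ((of_int k)\<^sup>2) ^ (l - 1)"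
    if l: "l \<ge> 1" for l k
  proof -
    obtain j where j: "l = Suc j" using l by (cases l) auto
    have "R powi (2 * int l - 3) * R = R powi (2 * int l - 3 + 1)"
      using R by (intro power_int_add_1 [symmetric]) simp
    also have "2 * int l - 3 + 1 = int (2 * j)" by (simp add: j)
    also have "R powi int (2 * j) = (R\<^sup>2) ^ j" by (simp only: power_int_of_nat power_mult)
    finally have p: "R powi (2 * int l - 3) * R = (R\<^sup>2) ^ j" .
    have q: "2 * pi * of_int k / L = of_int k / R" unfolding R(2) by simp
    have "R powi (2 * int l - 3) * (L * ((2 * pi * of_int k / L)\<^sup>2) ^ (l - 1))
        = 2 * pi * ((R powi (2 * int l - 3) * R) * (((of_int k / R)\<^sup>2) ^ j))"
      unfolding q j by (subst R(2)) simp
    also have "\<dots> = 2 * pi * ((of_int k)\<^sup>2) ^ (l - 1)"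
      unfolding p using R(1) by (simp add: j power_divide)
    finally show ?thesis .
  qed
  have "((\<lambda>k. \<Sum>l=1..m-1. s_coeff m l * R powi (2 * int l - 3) *
      (L * ((2 * pi * of_int k / L)\<^sup>2) ^ (l - 1) * (((of_int k)\<^sup>2 - 1)\<^sup>2 * c k))) has_sum ?A) UNIV"
    unfolding R_def c_def
    by (intro has_sum_finite_sum has_sum_cmult_right parseval_second_order_defect [OF L z(1) per]) auto
  moreover have "(\<Sum>l=1..m-1. s_coeff m l * R powi (2 * int l - 3) *
      (L * ((2 * pi * of_int k / L)\<^sup>2) ^ (l - 1) * (((of_int k)\<^sup>2 - 1)\<^sup>2 * c k)))
      = 2 * pi * poly (S_poly m) ((of_int k)\<^sup>2) * (((of_int k)\<^sup>2 - 1)\<^sup>2 * c k)" for k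
  proof -
    have "s_coeff m l * R powi (2 * int l - 3) * (L * ((2 * pi * of_int k / L)\<^sup>2) ^ (l - 1) * (((of_int k)\<^sup>2 - 1)\<^sup>2 * c k))
        = s_coeff m l * ((of_int k)\<^sup>2) ^ (l - 1) * (2 * pi * (((of_int k)\<^sup>2 - 1)\<^sup>2 * c k))"
      if "l \<in> {1..m-1}" for l
    proof -
      have "s_coeff m l * R powi (2 * int l - 3) * (L * ((2 * pi * of_int k / L)\<^sup>2) ^ (l - 1) * (((of_int k)\<^sup>2 - 1)\<^sup>2 * c k))
          = s_coeff m l * (R powi (2 * int l - 3) * (L * ((2 * pi * of_int k / L)\<^sup>2) ^ (l - 1))) * (((of_int k)\<^sup>2 - 1)\<^sup>2 * c k)"
        by (simp only: mult.assoc)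
      also have "\<dots> = s_coeff m l * (2 * pi * ((of_int k)\<^sup>2) ^ (l - 1)) * (((of_int k)\<^sup>2 - 1)\<^sup>2 * c k)"
        using that by (subst scale) auto
      finally show ?thesis by (simp only: mult_ac)
    qed
    then have "(\<Sum>l=1..m-1. s_coeff m l * R powi (2 * int l - 3) *
        (L * ((2 * pi * of_int k / L)\<^sup>2) ^ (l - 1) * (((of_int k)\<^sup>2 - 1)\<^sup>2 * c k)))
        = poly (S_poly m) ((of_int k)\<^sup>2) * (2 * pi * (((of_int k)\<^sup>2 - 1)\<^sup>2 * c k))"
      unfolding sum_s_coeff [symmetric] sum_distrib_right by (intro sum.cong refl)
    then show ?thesis by (simp only: mult_ac)
  qed
  ultimately have A: "((\<lambda>k. 2 * pi * poly (S_poly m) ((of_int k)\<^sup>2) * (((of_int k)\<^sup>2 - 1)\<^sup>2 * c k)) has_sum ?A) UNIV"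
    by simp
  have X: "((\<lambda>k. - ?c * (2 * pi * (((of_int k)\<^sup>2 - 1) * c k))) has_sum - ?c * ?X) UNIV"
    unfolding c_def
    by (intro has_sum_cmult_right isoperimetric_defect_has_sum [OF L per z unit normal area])
  have "2 * pi * poly (S_poly m) ((of_int k)\<^sup>2) * (((of_int k)\<^sup>2 - 1)\<^sup>2 * c k) + - ?c * (2 * pi * (((of_int k)\<^sup>2 - 1) * c k))
      = 2 * pi * (mode_weight m k * c k)" for k
    unfolding mode_weight_eq [OF z(2)] P_poly_eq_S_poly [of m "(of_int k)\<^sup>2"] poly_P_poly_1 [OF z(2)]
    by (simp add: power2_eq_square algebra_simps)
  then show ?thesis
    using has_sum_add [OF A X] by (simp add: c_def)
qed

section \<open>Curves with finitely many frequencies\<close>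

text \<open>If the smallest and largest frequencies \<open>q < p\<close> with nonzero coefficients were different, the
squared modulus would have the Fourier coefficient \<open>a p * cnj (a q)\<close> at frequency \<open>p - q\<close>, to which no
other pair contributes.\<close>

lemma unimodular_mode_sum:
  assumes L: "L > 0" and K: "finite K"
    and unit: "\<And>s. norm (\<Sum>k\<in>K. a k * fourier_mode L k s) = 1"
  obtains k where "k \<in> K" "\<And>j. j \<in> K \<Longrightarrow> j \<noteq> k \<Longrightarrow> a j = 0"
proof -
  define S where "S = {k\<in>K. a k \<noteq> 0}"
  have S: "finite S" using K by (simp add: S_def)
  have sumS: "(\<Sum>k\<in>K. a k * fourier_mode L k s) = (\<Sum>k\<in>S. a k * fourier_mode L k s)" for s
    unfolding S_def using K by (intro sum.mono_neutral_right) auto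
  have "S \<noteq> {}"
    using unit [of 0] unfolding sumS by auto
  define p q where "p = Max S" and "q = Min S"
  have pq: "p \<in> S" "q \<in> S" "\<And>k. k \<in> S \<Longrightarrow> q \<le> k \<and> k \<le> p"
    using S \<open>S \<noteq> {}\<close> by (auto simp: p_def q_def)
  have "p = q"
  proof (rule ccontr)
    assume "p \<noteq> q"
    have one: "(\<Sum>x\<in>S \<times> S. (a (fst x) * cnj (a (snd x))) * fourier_mode L (fst x - snd x) s) = 1" for s
    proof -
      have "(\<Sum>x\<in>S \<times> S. (a (fst x) * cnj (a (snd x))) * fourier_mode L (fst x - snd x) s)
          = (\<Sum>k\<in>S. a k * fourier_mode L k s) * cnj (\<Sum>k\<in>S. a k * fourier_mode L k s)"
        by (simp add: sum_product sum.cartesian_product case_prod_unfold cnj_fourier_mode mult_ac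
            flip: fourier_mode_add [of L _ "- _", simplified])
      also have "\<dots> = 1"
        unfolding complex_norm_square [symmetric] sumS [symmetric] unit by simp
      finally show ?thesis .
    qed
    have "0 = fourier_coeff L (\<lambda>s. \<Sum>k\<in>{0}. 1 * fourier_mode L k s) (p - q)"
      using \<open>p \<noteq> q\<close> L by (subst fourier_coeff_mode_sum) auto
    also have "\<dots> = fourier_coeff L (\<lambda>s. \<Sum>x\<in>S \<times> S. (a (fst x) * cnj (a (snd x))) * fourier_mode L (fst x - snd x) s) (p - q)"
      by (simp add: one)
    also have "\<dots> = (\<Sum>x\<in>S \<times> S. if fst x - snd x = p - q then a (fst x) * cnj (a (snd x)) else 0)"
      using L S by (intro fourier_coeff_mode_family) auto
    also have "\<dots> = (\<Sum>x\<in>S \<times> S. if x = (p, q) then a (fst x) * cnj (a (snd x)) else 0)"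
    proof (rule sum.cong [OF refl])
      fix x assume "x \<in> S \<times> S"
      then have "fst x \<le> p" "q \<le> snd x" using pq by auto
      then have "fst x - snd x = p - q \<longleftrightarrow> x = (p, q)" by (auto simp: prod_eq_iff)
      then show "(if fst x - snd x = p - q then a (fst x) * cnj (a (snd x)) else 0)
          = (if x = (p, q) then a (fst x) * cnj (a (snd x)) else 0)" by simp
    qed
    also have "\<dots> = a p * cnj (a q)"
      using S pq by (simp add: sum.delta)
    finally show False using pq by (simp add: S_def)
  qed
  then have "a j = 0" if "j \<in> K" "j \<noteq> p" for j
    using pq(3) [of j] that by (force simp: S_def)
  moreover have "p \<in> K" using pq by (simp add: S_def)
  ultimately show ?thesis using that by blast
qed

text \<open>Differentiation multiplies each coefficient by its frequency, so \<open>z'\<close> is a trigonometric polynomial too, of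
modulus one. Its single mode is not the constant one, and it determines \<open>z\<close> up to the mean value, which
is assumed to be zero.\<close>

lemma finite_spectrum_unit_speed_single_mode:
  fixes z :: "real \<Rightarrow> complex"
  assumes L: "L > 0" and per: "\<And>s. z (s + L) = z s" and z: "Ck m z" "m \<ge> 1"
    and unit: "\<And>s. norm (iterated_derivative 1 z s) = 1"
    and zero: "fourier_coeff L z 0 = 0" "\<And>k. \<bar>k\<bar> > int N \<Longrightarrow> fourier_coeff L z k = 0"
  obtains k b where "k \<noteq> 0" "b \<noteq> 0" "\<And>s. z s = b * fourier_mode L k s"
proof -
  let ?c = "fourier_coeff L z"
  define K where "K = {- int N..int N}"
  define d where "d k = \<i> * of_real (2 * pi * of_int k / L) * ?c k" for k
  have K: "finite K" by (simp add: K_def)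
  have d: "fourier_coeff L (iterated_derivative 1 z) k = d k" for k
    using fourier_coeff_iterated_derivative [OF L z(1) per z(2)] by (simp add: d_def)
  have z': "iterated_derivative 1 z s = (\<Sum>k\<in>K. d k * fourier_mode L k s)" for s
  proof -
    let ?f = "\<lambda>s. iterated_derivative 1 z s - (\<Sum>k\<in>K. d k * fourier_mode L k s)"
    have c1: "continuous_on A (iterated_derivative 1 z)" for A
      using Ck_continuous [OF z] continuous_on_subset by blast
    have "?f s = 0"
    proof (rule eq_0_if_fourier_coeffs_0 [OF L])
      show "continuous_on UNIV ?f" by (intro continuous_intros c1)
      show "?f (s + L) = ?f s" for s
        unfolding iterated_derivative_periodic [OF z(1) per z(2)] using L by (simp add: fourier_mode_periodic)
      show "fourier_coeff L ?f k = 0" for k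
      proof -
        have "fourier_coeff L ?f k = d k - (if k \<in> K then d k else 0)"
          by (subst fourier_coeff_diff, intro c1, intro continuous_intros)
            (simp only: d fourier_coeff_mode_sum [OF L K])
        then show ?thesis by (auto simp: K_def d_def zero(2))
      qed
    qed
    then show ?thesis by simp
  qed
  obtain k where k: "k \<in> K" "\<And>j. j \<in> K \<Longrightarrow> j \<noteq> k \<Longrightarrow> d j = 0"
    using unimodular_mode_sum [OF L K, of d] unit unfolding z' by blast
  have "d k \<noteq> 0"
  proof
    assume "d k = 0"
    then have "d j = 0" if "j \<in> K" for j using k that by (cases "j = k") auto
    then show False using unit [of 0] unfolding z' by simp
  qed
  then have nz: "k \<noteq> 0" "?c k \<noteq> 0" by (auto simp: d_def)
  have c: "?c j = 0" if "j \<noteq> k" for j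
  proof (cases "j = 0 \<or> j \<notin> K")
    case True
    then show ?thesis using zero by (auto simp: K_def)
  next
    case False
    then show ?thesis using k(2) [of j] that L by (simp add: d_def)
  qed
  have "z s = ?c k * fourier_mode L k s" for s
  proof -
    let ?f = "\<lambda>s. z s - (\<Sum>j\<in>{k}. ?c j * fourier_mode L j s)"
    have c0: "continuous_on A z" for A
      using Ck_continuous [OF z(1), of 0] continuous_on_subset by auto
    have "?f s = 0"
    proof (rule eq_0_if_fourier_coeffs_0 [OF L])
      show "continuous_on UNIV ?f" by (intro continuous_intros c0)
      show "?f (s + L) = ?f s" for s
        using L by (simp add: per fourier_mode_periodic)
      show "fourier_coeff L ?f j = 0" for j
        by (subst fourier_coeff_diff)
          (auto intro!: continuous_intros c0 simp: fourier_coeff_mode_sum [OF L, of "{k}" ?c, simplified] c)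
    qed
    then show ?thesis by simp
  qed
  then show ?thesis using nz that by blast
qed

text \<open>A mode of frequency \<open>k\<close> runs \<open>|k|\<close> times around the circle and returns to its starting point after
the fraction \<open>1/|k|\<close> of the period.\<close>

lemma simple_loop_mode:
  assumes L: "L > 0" and simple: "simple_path (loop_of L z)" and "k \<noteq> 0"
    and z: "\<And>s. z s = b * fourier_mode L k s"
  shows "\<bar>k\<bar> = 1"
proof (rule ccontr)
  assume "\<bar>k\<bar> \<noteq> 1"
  then have k: "\<bar>k\<bar> > 1" using \<open>k \<noteq> 0\<close> by linarith
  define t where "t = 1 / real_of_int \<bar>k\<bar>"
  have t: "0 < t" "t < 1" using k by (auto simp: t_def)
  have "fourier_mode L k (L * t) = cis (2 * pi * of_int (sgn k))"
    using L k by (cases "k > 0") (auto simp: fourier_mode_def t_def)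
  also have "\<dots> = 1" by (rule cis_multiple_2pi) simp
  finally have "loop_of L z t = loop_of L z 0"
    by (simp add: loop_of_def z)
  then show False
    using simple t unfolding simple_path_def loop_free_def by force
qed

theorem theorem1:
  fixes m :: nat and L F :: real and z n :: "real \<Rightarrow> complex" and \<Omega> :: "complex set"
  assumes "m \<ge> 1"
    and "L > 0"
    and periodic: "\<And>s. z (s + L) = z s"
    and smooth: "Ck m z"
    and unit_speed: "\<And>s. norm (vector_derivative z (at s)) = 1"
    and simple: "simple_path (loop_of L z)"
    and domain: "open \<Omega>" "connected \<Omega>"
    and boundary: "frontier \<Omega> = path_image (loop_of L z)"
    and area: "\<Omega> \<in> lmeasurable" "F = measure lebesgue \<Omega>"
    and orientation: "counterclockwise \<Omega> (loop_of L z)"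
    and normal: "\<And>s. s \<in> {0..L} \<Longrightarrow> outward_unit_normal \<Omega> z s (n s)"
    and centroid: "integral {0..L} z = 0"
  shows "let E =
      (\<Sum>l=1..m-1. s_coeff m l * (L / (2 * pi)) powi (2 * int l - 3) *
        integral {0..L} (\<lambda>s. (norm (iterated_derivative (l - 1)
          (\<lambda>r. z r + (L / (2 * pi))\<^sup>2 *\<^sub>R curvature_vector z r) s))\<^sup>2))
      - (- 1) ^ m / 2 * fact (m - 1) * fact (m + 1) *
        (1 / pi * (L\<^sup>2 - 4 * pi * F)
         - 2 * pi / L * integral {0..L} (\<lambda>s. (norm (z s - (L / (2 * pi)) *\<^sub>R n s))\<^sup>2))
    in 0 \<le> E \<and>
       (E = 0 \<longleftrightarrow> (\<exists>b. b \<noteq> 0 \<and> (\<forall>t. z (L / (2 * pi) * t) = b * exp (\<i> * of_real t))))"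
proof -
  let ?z' = "iterated_derivative 1 z"
  let ?c = "fourier_coeff L z"
  define E where "E =
      (\<Sum>l=1..m-1. s_coeff m l * (L / (2 * pi)) powi (2 * int l - 3) *
        integral {0..L} (\<lambda>s. (norm (iterated_derivative (l - 1)
          (\<lambda>r. z r + (L / (2 * pi))\<^sup>2 *\<^sub>R curvature_vector z r) s))\<^sup>2))
      - (- 1) ^ m / 2 * fact (m - 1) * fact (m + 1) *
        (1 / pi * (L\<^sup>2 - 4 * pi * F)
         - 2 * pi / L * integral {0..L} (\<lambda>s. (norm (z s - (L / (2 * pi)) *\<^sub>R n s))\<^sup>2))"
  note L = \<open>L > 0\<close> and m = \<open>m \<ge> 1\<close>
  have deriv: "(z has_vector_derivative ?z' s) (at s)" for s
    using Ck_has_vector_derivative [OF smooth, of 0 s] m by simp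
  have cont: "continuous_on UNIV ?z'"
    by (rule Ck_continuous [OF smooth m])
  have unit: "norm (?z' s) = 1" for s
    using unit_speed [of s] vector_derivative_at [OF deriv] by simp
  have closed: "z L = z 0" using periodic [of 0] by simp
  have n: "n s = - \<i> * ?z' s" if "0 < s" "s < L" for s
    using that by (intro outward_unit_normal_eq [OF L deriv cont unit closed simple domain(1) boundary orientation])
      (auto intro: normal)
  have area': "((\<lambda>s. Re (z s) * Im (?z' s) - Im (z s) * Re (?z' s)) has_integral 2 * F) {0..L}"
    unfolding area(2)
    by (rule area_eq_line_integral [OF L closed deriv cont simple domain(1) boundary orientation area(1)])
  have sum: "((\<lambda>k. 2 * pi * (mode_weight m k * (norm (?c k))\<^sup>2)) has_sum E) UNIV"
    unfolding E_def by (rule energy_has_sum [OF L periodic smooth m unit n area'])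
  have c0: "?c 0 = 0"
    using centroid by (simp add: fourier_coeff_def)
  have nonneg: "0 \<le> 2 * pi * (mode_weight m k * (norm (?c k))\<^sup>2)" for k
    using mode_weight_nonneg [of k m] c0 by (cases "k = 0") auto
  have "0 \<le> E"
    by (rule has_sum_nonneg [OF sum]) (rule nonneg)
  moreover have "\<exists>b. b \<noteq> 0 \<and> (\<forall>t. z (L / (2 * pi) * t) = b * exp (\<i> * of_real t))" if "E = 0"
  proof -
    have "?c k = 0" if k: "\<bar>k\<bar> > int m" for k
    proof -
      have "2 * pi * (mode_weight m k * (norm (?c k))\<^sup>2) = 0"
        using nonneg_has_sum_le_0D [OF sum] nonneg \<open>E = 0\<close> by simp
      then show ?thesis using mode_weight_pos [OF k] by simp
    qed
    then obtain k b where k: "k \<noteq> 0" "b \<noteq> 0" "\<And>s. z s = b * fourier_mode L k s"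
      using finite_spectrum_unit_speed_single_mode [OF L periodic smooth m unit c0] by blast
    have "\<bar>k\<bar> = 1" by (rule simple_loop_mode [OF L simple k(1,3)])
    moreover have "k \<noteq> - 1"
    proof
      \<comment> \<open>The clockwise circle would enclose negative area.\<close>
      assume "k = - 1"
      have "(z has_vector_derivative b * (\<i> * of_real (2 * pi * of_int k / L) * fourier_mode L k s)) (at s)" for s
        unfolding k(3) [abs_def] by (intro has_vector_derivative_mult_right has_vector_derivative_fourier_mode)
      from vector_derivative_unique_at [OF deriv this]
      have z': "?z' s = \<i> * of_real (- (2 * pi / L)) * z s" for s
        by (simp add: \<open>k = - 1\<close> k(3))
      have "Re (z s) * Im (?z' s) - Im (z s) * Re (?z' s) = - (2 * pi / L) * (norm b)\<^sup>2" for s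
      proof -
        have "Re (z s) * Im (?z' s) - Im (z s) * Re (?z' s) = - (2 * pi / L) * (norm (z s))\<^sup>2"
          unfolding z' cmod_power2 by (simp add: power2_eq_square algebra_simps)
        also have "norm (z s) = norm b" by (simp add: k(3) norm_mult)
        finally show ?thesis .
      qed
      then have "((\<lambda>s. - (2 * pi / L) * (norm b)\<^sup>2) has_integral 2 * F) {0..L}"
        using area' by (simp only:)
      moreover have "((\<lambda>s. - (2 * pi / L) * (norm b)\<^sup>2) has_integral L * (- (2 * pi / L) * (norm b)\<^sup>2)) {0..L}"
        using has_integral_const_real [of "- (2 * pi / L) * (norm b)\<^sup>2" 0 L] L by simp
      ultimately have "2 * F = L * (- (2 * pi / L) * (norm b)\<^sup>2)"
        by (rule has_integral_unique)
      also have "\<dots> < 0" using L k(2) by simp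
      finally show False using area(2) by simp
    qed
    ultimately have "k = 1" by linarith
    then have "z (L / (2 * pi) * t) = b * exp (\<i> * of_real t)" for t
      using L by (simp add: k(3) fourier_mode_def cis_conv_exp)
    then show ?thesis using k(2) by blast
  qed
  moreover have "E = 0" if b: "\<forall>t. z (L / (2 * pi) * t) = b * exp (\<i> * of_real t)" for b
  proof -
    have "z s = (\<Sum>j\<in>{1}. b * fourier_mode L j s)" for s
      using b [rule_format, of "2 * pi * s / L"] L by (simp add: fourier_mode_def cis_conv_exp)
    then have z: "z = (\<lambda>s. \<Sum>j\<in>{1}. b * fourier_mode L j s)" by blast
    have "?c k = (if k \<in> {1} then b else 0)" for k
      by (subst z, rule fourier_coeff_mode_sum [OF L]) simp
    then have vanish: "2 * pi * (mode_weight m k * (norm (?c k))\<^sup>2) = 0" for k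
      using mode_weight_0 [of 1 m] m by simp
    have "((\<lambda>k::int. 0) has_sum E) UNIV" using sum unfolding vanish .
    then show ?thesis using has_sum_0_simp has_sum_unique by blast
  qed
  ultimately show ?thesis
    unfolding Let_def E_def [symmetric] by blast
qed

end
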